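(* There is a positive constant $C=C(n)$, depending only on $n$, such that for all $x',x''\in\mathbb R^n$, $r_1,r_2>0$, $T>S\ge 0$ and all $u_0\in L^2(\mathbb R^n;\mathbb C)$, $$\int_{\mathbb R^n}|u_0(x)|^2\,dx\le C e^{C r_1r_2\frac{1}{T-S}}\Big(\int_{B_{r_1}^c(x')}|u(x,S;u_0)|^2\,dx+\int_{B_{r_2}^c(x'')}|u(x,T;u_0)|^2\,dx\Big).$$
   Context: Here $n\in\{1,2,\dots\}$ is fixed. For $u_0\in L^2(\mathbb R^n;\mathbb C)$ and $t\ge 0$, $u(x,t;u_0)=(e^{i\Delta t}u_0)(x)$ denotes the solution of the free Schrödinger equation $i\partial_t u+\Delta u=0$ in $\mathbb R^n\times(0,\infty)$ with $u(x,0)=u_0(x)$. $B_r(x)$ is the closed ball in $\mathbb R^n$ centered at $x$ of radius $r$, and $B_r^c(x)$ is its complement in $\mathbb R^n$. *)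

theory Defs
  imports "HOL-Analysis.Analysis"
begin

text \<open>
  Elements of \<open>L\<^sup>2(\<real>\<^sup>n; \<complex>)\<close> are represented by Lebesgue measurable functions rather
  than by equivalence classes modulo null sets.
\<close>

definition square_integrable :: "(real ^ 'n \<Rightarrow> complex) \<Rightarrow> bool" where
  "square_integrable f \<longleftrightarrow>
     f \<in> borel_measurable lebesgue \<and> integrable lebesgue (\<lambda>x. (cmod (f x))\<^sup>2)"

text \<open>The unitary normalisation of the Fourier transform; meaningful for integrable \<open>f\<close>.\<close>

definition fourier_L1 :: "(real ^ 'n \<Rightarrow> complex) \<Rightarrow> real ^ 'n \<Rightarrow> complex" where
  "fourier_L1 f \<xi> =
     complex_of_real ((2 * pi) powr (- real CARD('n) / 2)) *
     (LINT x|lebesgue. f x * cis (- (x \<bullet> \<xi>)))"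

text \<open>
  The Fourier--Plancherel transform of \<open>f \<in> L\<^sup>2\<close>: the limit in \<open>L\<^sup>2\<close>, as \<open>R \<rightarrow> \<infinity>\<close>, of the
  transforms of the truncations of \<open>f\<close> to the balls of radius \<open>R\<close>, which are integrable.
  The limit is unique only up to null sets, so a representative is chosen. The distance is
  measured by the nonnegative integral because the Bochner integral of a non-integrable
  function is 0.
\<close>

definition fourier_L2 :: "(real ^ 'n \<Rightarrow> complex) \<Rightarrow> real ^ 'n \<Rightarrow> complex" where
  "fourier_L2 f = (SOME g. square_integrable g \<and>
     ((\<lambda>R. \<integral>\<^sup>+\<xi>. ennreal ((cmod
          (fourier_L1 (\<lambda>x. indicator (cball 0 R) x *\<^sub>R f x) \<xi> - g \<xi>))\<^sup>2) \<partial>lebesgue)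
        \<longlongrightarrow> 0) at_top)"

text \<open>With the unitary normalisation, the inverse transform is the transform reflected at 0.\<close>

definition inverse_fourier_L2 :: "(real ^ 'n \<Rightarrow> complex) \<Rightarrow> real ^ 'n \<Rightarrow> complex" where
  "inverse_fourier_L2 g x = fourier_L2 g (- x)"

text \<open>
  \<open>free_schrodinger u\<^sub>0 t\<close> is \<open>e\<^bsup>i\<Delta>t\<^esup> u\<^sub>0\<close>. The Laplacian is multiplication by \<open>- |\<xi>|\<^sup>2\<close> on the
  Fourier side, which turns \<open>i \<partial>\<^sub>t u + \<Delta>u = 0\<close>, \<open>u(0) = u\<^sub>0\<close> into \<open>\<partial>\<^sub>t F u = - i |\<xi>|\<^sup>2 F u\<close>,
  \<open>(F u)(0) = F u\<^sub>0\<close>; the functional calculus therefore makes \<open>e\<^bsup>i\<Delta>t\<^esup>\<close> the Fourier multiplier with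
  symbol \<open>e\<^bsup>-it|\<xi>|\<^sup>2\<^esup>\<close>.
\<close>

definition free_schrodinger :: "(real ^ 'n \<Rightarrow> complex) \<Rightarrow> real \<Rightarrow> real ^ 'n \<Rightarrow> complex" where
  "free_schrodinger u\<^sub>0 t =
     inverse_fourier_L2 (\<lambda>\<xi>. cis (- (t * (norm \<xi>)\<^sup>2)) * fourier_L2 u\<^sub>0 \<xi>)"

end

theory Submission
  imports Defs "HOL-Probability.Characteristic_Functions"
begin

text \<open>
  Write \<open>v t = e\<^bsup>i\<Delta>t\<^esup> u\<^sub>0\<close>, \<open>\<phi>\<close> for the Fourier
  transform of \<open>u\<^sub>0\<close>, and \<open>B\<^sub>1\<close>, \<open>B\<^sub>2\<close> for the two
  balls. The inequality says that a solution cannot be almost concentrated in \<open>B\<^sub>1\<close> at time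
  \<open>S\<close> and in \<open>B\<^sub>2\<close> at time \<open>T\<close>. The proof is a quantitative
  extrapolation built on Galilean invariance.

  Multiplying \<open>v T\<close> by the character \<open>cis (\<beta> \<bullet> (x - x''))\<close> produces
  another solution at time \<open>T\<close>. Followed back to time \<open>S\<close>, this solution is, up to a
  unimodular factor, \<open>v S\<close> translated by \<open>2 (T - S) \<beta>\<close>. Hence a combination of
  powers of this boost acts at time \<open>T\<close> as multiplication by \<open>p (cis (\<beta> \<bullet> (x -
  x'')))\<close> for a polynomial \<open>p\<close>, and at time \<open>S\<close> as a combination of
  translations by multiples of \<open>2 (T - S) \<beta>\<close>, and both functions have the same norm
  (\<open>galilean_combination\<close>).

  Take \<open>|\<beta>| = 1 / (8 r\<^sub>2)\<close>, so that the character stays within \<open>1/8\<close> of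
  \<open>1\<close> on \<open>B\<^sub>2\<close>, and \<open>K > 8 r\<^sub>1 r\<^sub>2 / (T - S)\<close>, so that
  \<open>K\<close> or more translation steps carry a half-space that contains \<open>B\<^sub>1\<close> and whose
  boundary touches it out of \<open>B\<^sub>1\<close>. The upper half of the binomial expansion of \<open>(z +
  (1 - z)) ^ (2 K)\<close> is a polynomial \<open>p\<close> that is divisible by \<open>z ^ K\<close>, is within
  \<open>1/2\<close> of \<open>1\<close> where \<open>z\<close> is within \<open>1/8\<close> of \<open>1\<close>
  on the unit circle, and has coefficients of total size at most \<open>9 ^ K\<close>
  (\<open>extrapolation_polynomial\<close>). The function \<open>(1 - p) v T\<close> is then at most half of
  \<open>v T\<close> on \<open>B\<^sub>2\<close>, and so its norm is controlled by half the total norm and the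
  mass of \<open>v T\<close> outside \<open>B\<^sub>2\<close>. At time \<open>S\<close> it differs from \<open>v
  S\<close>, on the half-space, only by translated values of \<open>v S\<close> that are taken outside
  \<open>B\<^sub>1\<close>. The half of the total mass that appears on the right is absorbed on the left
  (\<open>two_time_inequality\<close>), and \<open>9 ^ K\<close> is the origin of the exponential constant.

  Of the Fourier--Plancherel transform the argument uses that it is linear and isometric and that it exchanges
  translations and modulations. Every solution above is written in terms of \<open>\<phi>\<close>, from where
  each of the two times is reached by one isometry. The isometry property comes from inserting a Gaussian weight
  into \<open>\<integral> |F f|\<^sup>2\<close>: by Fubini the weighted integral is an autocorrelation of
  \<open>f\<close> against a heat kernel (\<open>gaussian_plancherel\<close>). The Schur bound for the kernel
  gives \<open>\<le>\<close> for every integrable \<open>f\<close>, and letting the kernel concentrate gives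
  \<open>\<ge>\<close> for bounded continuous \<open>f\<close>, which are dense. The completeness of
  \<open>L\<^sup>2\<close> then provides the limit of truncated transforms.
\<close>

section \<open>Square integrable functions\<close>

text \<open>
  The squared norm takes values in the extended half-line, so that it can be estimated before
  square integrability is known.
\<close>

definition sqnorm :: "'a measure \<Rightarrow> ('a \<Rightarrow> complex) \<Rightarrow> ennreal" where
  "sqnorm M f = (\<integral>\<^sup>+x. ennreal ((cmod (f x))\<^sup>2) \<partial>M)"

lemma sqnorm_cong_AE:
  assumes "AE x in M. f x = g x"
  shows "sqnorm M f = sqnorm M g"
  unfolding sqnorm_def by (rule nn_integral_cong_AE) (use assms in eventually_elim, simp)

lemma sqnorm_minus_commute: "sqnorm M (\<lambda>x. f x - g x) = sqnorm M (\<lambda>x. g x - f x)"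
  unfolding sqnorm_def by (simp add: norm_minus_commute)

text \<open>
  The free parameter \<open>\<delta>\<close> replaces the triangle inequality for the norm: \<open>\<delta> = 1\<close> is enough for
  estimates up to a factor, and \<open>\<delta> \<rightarrow> 0\<close> recovers sharp constants in the limit.
\<close>

lemma cmod_add_sq_le:
  assumes "\<delta> > 0"
  shows "(cmod (a + b))\<^sup>2 \<le> (1 + \<delta>) * (cmod a)\<^sup>2 + (1 + 1 / \<delta>) * (cmod b)\<^sup>2"
proof -
  define p where "p = cmod a"
  define q where "q = cmod b"
  have "(cmod (a + b))\<^sup>2 \<le> (p + q)\<^sup>2"
    unfolding p_def q_def by (intro power_mono norm_triangle_ineq) simp
  moreover have "2 * p * q \<le> \<delta> * p\<^sup>2 + q\<^sup>2 / \<delta>"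
  proof -
    have "0 \<le> (\<delta> * p - q)\<^sup>2 / \<delta>" using assms by simp
    also have "\<dots> = \<delta> * p\<^sup>2 + q\<^sup>2 / \<delta> - 2 * p * q"
      using assms by (simp add: power2_diff power2_eq_square field_simps)
    finally show ?thesis by simp
  qed
  ultimately have "(cmod (a + b))\<^sup>2 \<le> p\<^sup>2 + q\<^sup>2 + (\<delta> * p\<^sup>2 + q\<^sup>2 / \<delta>)"
    by (simp add: power2_sum)
  also have "\<dots> = (1 + \<delta>) * p\<^sup>2 + (1 + 1 / \<delta>) * q\<^sup>2"
    using assms by (simp add: field_simps)
  finally show ?thesis unfolding p_def q_def .
qed

lemma sqnorm_add_le_weighted:
  assumes [measurable]: "f \<in> borel_measurable M" "g \<in> borel_measurable M" and "\<delta> > 0"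
  shows "sqnorm M (\<lambda>x. f x + g x)
           \<le> ennreal (1 + \<delta>) * sqnorm M f + ennreal (1 + 1 / \<delta>) * sqnorm M g"
proof -
  have "sqnorm M (\<lambda>x. f x + g x)
      \<le> (\<integral>\<^sup>+x. ennreal (1 + \<delta>) * ennreal ((cmod (f x))\<^sup>2) +
             ennreal (1 + 1 / \<delta>) * ennreal ((cmod (g x))\<^sup>2) \<partial>M)"
    unfolding sqnorm_def using assms(3) cmod_add_sq_le[OF assms(3)]
    by (intro nn_integral_mono)
       (simp add: ennreal_mult[symmetric] ennreal_plus[symmetric] del: ennreal_plus)
  also have "\<dots> = ennreal (1 + \<delta>) * sqnorm M f + ennreal (1 + 1 / \<delta>) * sqnorm M g"
    unfolding sqnorm_def by (simp add: nn_integral_add nn_integral_cmult)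
  finally show ?thesis .
qed

lemma sqnorm_add_le:
  assumes "f \<in> borel_measurable M" "g \<in> borel_measurable M"
  shows "sqnorm M (\<lambda>x. f x + g x) \<le> 2 * sqnorm M f + 2 * sqnorm M g"
  using sqnorm_add_le_weighted[OF assms, of 1] by simp

lemma sqnorm_diff_triangle:
  assumes [measurable]: "f \<in> borel_measurable M" "g \<in> borel_measurable M" "h \<in> borel_measurable M"
  shows "sqnorm M (\<lambda>x. f x - h x)
           \<le> 2 * sqnorm M (\<lambda>x. f x - g x) + 2 * sqnorm M (\<lambda>x. g x - h x)"
  using sqnorm_add_le[of "\<lambda>x. f x - g x" M "\<lambda>x. g x - h x"] by simp

lemma sqnorm_cmult:
  assumes "f \<in> borel_measurable M"
  shows "sqnorm M (\<lambda>x. c * f x) = ennreal ((cmod c)\<^sup>2) * sqnorm M f"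
  using assms unfolding sqnorm_def
  by (simp add: norm_mult power_mult_distrib ennreal_mult nn_integral_cmult)

lemma sqnorm_unimodular:
  assumes "\<And>x. cmod (c x) = 1"
  shows "sqnorm M (\<lambda>x. c x * f x) = sqnorm M f"
  using assms unfolding sqnorm_def by (simp add: norm_mult)

text \<open>
  The squared norm is continuous along sequences that converge in mean square. This is the form in
  which equalities and inequalities of norms are extended from a dense class. The weighted inequality
  gives \<open>sqnorm f \<le> (1 + \<delta>)\<^sup>2 sqnorm g\<close> for each \<open>\<delta> > 0\<close>.
\<close>

lemma sqnorm_tendsto_le:
  fixes f g :: "'a \<Rightarrow> complex" and f' g' :: "nat \<Rightarrow> 'a \<Rightarrow> complex"
  assumes [measurable]: "f \<in> borel_measurable M" "g \<in> borel_measurable M"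
    "\<And>n. f' n \<in> borel_measurable M" "\<And>n. g' n \<in> borel_measurable M"
  assumes f: "(\<lambda>n. sqnorm M (\<lambda>x. f' n x - f x)) \<longlonglongrightarrow> 0"
    and g: "(\<lambda>n. sqnorm M (\<lambda>x. g' n x - g x)) \<longlonglongrightarrow> 0"
    and le: "\<And>n. sqnorm M (f' n) \<le> sqnorm M (g' n)"
  shows "sqnorm M f \<le> sqnorm M g"
proof -
  have weighted: "sqnorm M f \<le> ennreal (1 + \<delta>) * (ennreal (1 + \<delta>) * sqnorm M g)" if "\<delta> > 0" for \<delta>
  proof (rule LIMSEQ_le_const)
    let ?a = "\<lambda>n. ennreal (1 + \<delta>) * (ennreal (1 + \<delta>) * sqnorm M g + ennreal (1 + 1 / \<delta>) * sqnorm M (\<lambda>x. g' n x - g x))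
       + ennreal (1 + 1 / \<delta>) * sqnorm M (\<lambda>x. f' n x - f x)"
    have "?a \<longlonglongrightarrow> ennreal (1 + \<delta>) * (ennreal (1 + \<delta>) * sqnorm M g + ennreal (1 + 1 / \<delta>) * 0) + ennreal (1 + 1 / \<delta>) * 0"
      by (intro tendsto_add ennreal_tendsto_cmult tendsto_const f g) (auto simp: ennreal_less_top)
    thus "?a \<longlonglongrightarrow> ennreal (1 + \<delta>) * (ennreal (1 + \<delta>) * sqnorm M g)" by simp
    show "\<exists>N. \<forall>n\<ge>N. sqnorm M f \<le> ?a n"
    proof (intro exI[of _ 0] allI impI)
      fix n
      have "sqnorm M f = sqnorm M (\<lambda>x. f' n x + (f x - f' n x))" by simp
      also have "\<dots> \<le> ennreal (1 + \<delta>) * sqnorm M (f' n) + ennreal (1 + 1 / \<delta>) * sqnorm M (\<lambda>x. f x - f' n x)"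
        by (rule sqnorm_add_le_weighted) (use that in auto)
      also have "sqnorm M (f' n) \<le> sqnorm M (g' n)" by (rule le)
      also have "sqnorm M (g' n) = sqnorm M (\<lambda>x. g x + (g' n x - g x))" by simp
      also have "\<dots> \<le> ennreal (1 + \<delta>) * sqnorm M g + ennreal (1 + 1 / \<delta>) * sqnorm M (\<lambda>x. g' n x - g x)"
        by (rule sqnorm_add_le_weighted) (use that in auto)
      finally show "sqnorm M f \<le> ?a n"
        by (simp add: sqnorm_minus_commute[of M f] add_mono mult_left_mono)
    qed
  qed
  show ?thesis
  proof (cases "sqnorm M g = \<infinity>")
    case False
    show ?thesis
    proof (rule LIMSEQ_le_const)
      let ?d = "\<lambda>n. ennreal (1 + 1 / real (Suc n))"
      have "(\<lambda>n. 1 + 1 / real (Suc n)) \<longlonglongrightarrow> 1 + 0"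
        by (intro tendsto_add tendsto_const LIMSEQ_Suc[OF lim_1_over_n])
      hence "?d \<longlonglongrightarrow> ennreal 1" by (intro tendsto_ennrealI) simp
      hence d: "?d \<longlonglongrightarrow> 1" by simp
      have "(\<lambda>n. sqnorm M g * ?d n) \<longlonglongrightarrow> sqnorm M g * 1"
        by (rule ennreal_tendsto_cmult[OF _ d]) (use False in \<open>simp add: less_top\<close>)
      moreover have "(\<lambda>n. ?d n * ?d n) \<longlonglongrightarrow> 1"
      proof -
        have "(\<lambda>n. (1 + 1 / real (Suc n)) * (1 + 1 / real (Suc n))) \<longlonglongrightarrow> (1 + 0) * (1 + 0)"
          by (intro tendsto_mult tendsto_add tendsto_const LIMSEQ_Suc[OF lim_1_over_n])
        hence "(\<lambda>n. ennreal ((1 + 1 / real (Suc n)) * (1 + 1 / real (Suc n)))) \<longlonglongrightarrow> ennreal 1"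
          by (intro tendsto_ennrealI) simp
        thus ?thesis by (simp add: ennreal_mult)
      qed
      hence "(\<lambda>n. sqnorm M g * (?d n * ?d n)) \<longlonglongrightarrow> sqnorm M g * 1"
        by (rule ennreal_tendsto_cmult[rotated]) (use False in \<open>simp add: less_top\<close>)
      thus "(\<lambda>n. ?d n * (?d n * sqnorm M g)) \<longlonglongrightarrow> sqnorm M g" by (simp add: mult_ac)
      show "\<exists>N. \<forall>n\<ge>N. sqnorm M f \<le> ?d n * (?d n * sqnorm M g)"
        using weighted by (intro exI[of _ 0]) simp
    qed
  qed simp
qed

text \<open>
  Riesz--Fischer. Along a subsequence with squared increments at most \<open>4\<^sup>-\<^sup>k\<close>, the sum of the squared
  increments weighted by \<open>2\<^sup>k\<close> is integrable. It is therefore finite almost everywhere, which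
  forces the increments to decay geometrically at almost every point. Fatou's lemma turns the
  pointwise limit into a limit in mean square.
\<close>

lemma sqnorm_complete:
  fixes g :: "nat \<Rightarrow> 'a \<Rightarrow> complex"
  assumes [measurable]: "\<And>n. g n \<in> borel_measurable M"
  assumes Cauchy: "\<And>e. e > 0 \<Longrightarrow> \<exists>N. \<forall>m\<ge>N. \<forall>n\<ge>N. sqnorm M (\<lambda>x. g m x - g n x) \<le> ennreal e"
  obtains G where "G \<in> borel_measurable M" "(\<lambda>n. sqnorm M (\<lambda>x. g n x - G x)) \<longlonglongrightarrow> 0"
proof -
  have "\<exists>r. strict_mono r \<and> (\<forall>k::nat. \<forall>m\<ge>r k. \<forall>n\<ge>r k. sqnorm M (\<lambda>x. g m x - g n x) \<le> ennreal ((1/4)^k))"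
  proof -
    have "\<exists>N. \<forall>m\<ge>N. \<forall>n\<ge>N. sqnorm M (\<lambda>x. g m x - g n x) \<le> ennreal ((1/4)^k)" for k :: nat
      by (rule Cauchy) simp
    then obtain N where N: "\<And>k m n. m \<ge> N k \<Longrightarrow> n \<ge> N k \<Longrightarrow> sqnorm M (\<lambda>x. g m x - g n x) \<le> ennreal ((1/4)^k)"
      by metis
    \<comment> \<open>Partial sums, so that the indices increase strictly and still dominate \<open>N\<close>.\<close>
    define r where "r k = (\<Sum>j\<le>k. Suc (N j))" for k
    have "strict_mono r" unfolding strict_mono_Suc_iff r_def by simp
    moreover have "N k \<le> r k" for k
      unfolding r_def using member_le_sum[of k "{..k}" "\<lambda>j. Suc (N j)"] by simp
    ultimately show ?thesis using N by (meson order_trans)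
  qed
  then obtain r where r: "strict_mono r"
    and small: "\<And>k m n. m \<ge> r k \<Longrightarrow> n \<ge> r k \<Longrightarrow> sqnorm M (\<lambda>x. g m x - g n x) \<le> ennreal ((1/4)^k)"
    by blast
  define d where "d k x = g (r (Suc k)) x - g (r k) x" for k x
  have [measurable]: "d k \<in> borel_measurable M" for k unfolding d_def by measurable
  \<comment> \<open>The weight \<open>2 ^ k\<close> is smaller than the gain \<open>4 ^ k\<close>, yet its square root is summable when inverted.\<close>
  have "(\<integral>\<^sup>+x. (\<Sum>k. ennreal (2^k) * ennreal ((cmod (d k x))\<^sup>2)) \<partial>M)
      = (\<Sum>k. ennreal (2^k) * sqnorm M (d k))"
    unfolding sqnorm_def by (subst nn_integral_suminf) (simp_all add: nn_integral_cmult)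
  also have "\<dots> \<le> (\<Sum>k. ennreal ((1/2)^k))"
  proof (intro suminf_le summableI)
    fix k
    have "r (Suc k) \<ge> r k" using r by (simp add: strict_mono_less_eq)
    hence "sqnorm M (d k) \<le> ennreal ((1/4)^k)"
      unfolding d_def by (intro small) auto
    hence "ennreal (2^k) * sqnorm M (d k) \<le> ennreal (2^k) * ennreal ((1/4)^k)"
      by (rule mult_left_mono) simp
    also have "\<dots> = ennreal ((1/2)^k)"
      by (simp add: ennreal_mult[symmetric] power_mult_distrib[symmetric] del: ennreal_power)
    finally show "ennreal (2^k) * sqnorm M (d k) \<le> ennreal ((1/2)^k)" .
  qed
  also have "\<dots> < \<infinity>"
    by (subst suminf_ennreal2) (auto intro!: summable_geometric)
  finally have "AE x in M. (\<Sum>k. ennreal (2^k) * ennreal ((cmod (d k x))\<^sup>2)) \<noteq> \<infinity>"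
    by (intro nn_integral_PInf_AE) auto
  hence conv: "AE x in M. convergent (\<lambda>k. g (r k) x)"
  proof eventually_elim
    case (elim x)
    define a where "a k = 2^k * (cmod (d k x))\<^sup>2" for k
    have a0: "a k \<ge> 0" for k by (simp add: a_def)
    have "(\<Sum>k. ennreal (a k)) \<noteq> \<infinity>" using elim by (simp add: a_def ennreal_mult)
    hence "summable a" using a0 by (intro summable_suminf_not_top) auto
    hence "bounded (range a)"
      by (intro convergent_imp_bounded) (rule summable_LIMSEQ_zero)
    then obtain B where B: "\<And>k. a k \<le> B"
      by (auto simp: bounded_iff abs_le_iff)
    have bound: "cmod (d k x) \<le> sqrt B * (1 / sqrt 2)^k" for k
    proof -
      have "(cmod (d k x))\<^sup>2 \<le> B / 2^k" using B[of k] by (simp add: a_def field_simps)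
      hence "cmod (d k x) \<le> sqrt (B / 2^k)" by (rule real_le_rsqrt)
      thus ?thesis by (simp add: real_sqrt_divide real_sqrt_power field_simps)
    qed
    have "summable (\<lambda>k. sqrt B * (1 / sqrt 2)^k)"
      by (intro summable_mult summable_geometric) simp
    hence "summable (\<lambda>k. d k x)"
      by (rule summable_comparison_test'[where N = 0]) (rule bound)
    hence "convergent (\<lambda>n. (\<Sum>k<n. d k x) + g (r 0) x)"
      by (intro convergent_add convergent_const) (simp add: summable_iff_convergent)
    moreover have "(\<Sum>k<n. d k x) + g (r 0) x = g (r n) x" for n
      unfolding d_def by (subst sum_lessThan_telescope[of "\<lambda>k. g (r k) x"]) simp
    ultimately show ?case by simp
  qed
  define G where "G x = lim (\<lambda>k. g (r k) x)" for x
  have [measurable]: "G \<in> borel_measurable M" unfolding G_def by measurable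
  have tail: "sqnorm M (\<lambda>x. g n x - G x) \<le> ennreal ((1/4)^k)" if "n \<ge> r k" for n k
  proof -
    have "sqnorm M (\<lambda>x. g n x - G x) = (\<integral>\<^sup>+x. liminf (\<lambda>j. ennreal ((cmod (g n x - g (r j) x))\<^sup>2)) \<partial>M)"
      unfolding sqnorm_def
    proof (rule nn_integral_cong_AE, use conv in eventually_elim)
      case (elim x)
      hence "(\<lambda>j. g (r j) x) \<longlonglongrightarrow> G x" unfolding G_def by (simp add: convergent_LIMSEQ_iff)
      hence "(\<lambda>j. ennreal ((cmod (g n x - g (r j) x))\<^sup>2)) \<longlonglongrightarrow> ennreal ((cmod (g n x - G x))\<^sup>2)"
        by (intro tendsto_intros)
      hence "liminf (\<lambda>j. ennreal ((cmod (g n x - g (r j) x))\<^sup>2)) = ennreal ((cmod (g n x - G x))\<^sup>2)"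
        by (rule lim_imp_Liminf[rotated]) simp
      thus ?case by (rule sym)
    qed
    also have "\<dots> \<le> liminf (\<lambda>j. sqnorm M (\<lambda>x. g n x - g (r j) x))"
      unfolding sqnorm_def by (rule nn_integral_liminf) measurable
    also have "\<dots> \<le> ennreal ((1/4)^k)"
    proof (rule Liminf_le)
      show "\<forall>\<^sub>F j in sequentially. sqnorm M (\<lambda>x. g n x - g (r j) x) \<le> ennreal ((1/4)^k)"
        using eventually_ge_at_top[of k]
        by eventually_elim (use that r in \<open>auto intro!: small simp: strict_mono_less_eq\<close>)
    qed simp
    finally show ?thesis .
  qed
  have "(\<lambda>n. sqnorm M (\<lambda>x. g n x - G x)) \<longlonglongrightarrow> 0"
  proof (rule order_tendstoI)
    fix y :: ennreal assume "0 < y"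
    have "(\<lambda>k. ennreal ((1/4::real)^k)) \<longlonglongrightarrow> ennreal 0"
      by (intro tendsto_ennrealI LIMSEQ_realpow_zero) auto
    hence "\<forall>\<^sub>F k in sequentially. ennreal ((1/4::real)^k) < y"
      using \<open>0 < y\<close> by (intro order_tendstoD(2)) auto
    then obtain k where k: "ennreal ((1/4::real)^k) < y" by (auto simp: eventually_sequentially)
    show "\<forall>\<^sub>F n in sequentially. sqnorm M (\<lambda>x. g n x - G x) < y"
      using eventually_ge_at_top[of "r k"] by eventually_elim (use tail k in \<open>meson le_less_trans\<close>)
  qed simp
  thus ?thesis using that[of G] by simp
qed

section \<open>Gaussian integrals\<close>

lemma borel_measurable_cis [measurable]: "cis \<in> borel_measurable borel"
  by (intro borel_measurable_continuous_onI continuous_intros)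

lemma integrable_prod_mult:
  fixes f :: "'a::euclidean_space \<Rightarrow> complex" and g :: "'b::euclidean_space \<Rightarrow> complex"
  assumes f: "integrable lborel f" and g: "integrable lborel g"
  shows "integrable (lborel \<Otimes>\<^sub>M lborel) (\<lambda>(x, y). f x * g y)"
proof (rule lborel_pair.Fubini_integrable)
  have [measurable]: "f \<in> borel_measurable borel" "g \<in> borel_measurable borel"
    using f g by (auto dest: borel_measurable_integrable)
  show "(\<lambda>(x, y). f x * g y) \<in> borel_measurable (lborel \<Otimes>\<^sub>M lborel)" by measurable
  show "integrable lborel (\<lambda>x. LINT y|lborel. norm (case (x, y) of (x, y) \<Rightarrow> f x * g y))"
    using f by (simp add: norm_mult)
  show "AE x in lborel. integrable lborel (\<lambda>y. case (x, y) of (x, y) \<Rightarrow> f x * g y)"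
    using g by simp
qed

text \<open>
  This is the characteristic function of the standard normal distribution after the substitution
  \<open>x = \<surd>\<epsilon> t\<close>.
\<close>

lemma gaussian_fourier_real:
  fixes a \<epsilon> :: real
  assumes "\<epsilon> > 0"
  shows "integrable lborel (\<lambda>t::real. exp (- \<epsilon> * t\<^sup>2 / 2))"
    and "(LINT t|lborel. cis (- (a * t)) * complex_of_real (exp (- \<epsilon> * t\<^sup>2 / 2)))
           = complex_of_real (sqrt (2 * pi / \<epsilon>) * exp (- a\<^sup>2 / (2 * \<epsilon>)))"
proof -
  have s: "sqrt \<epsilon> \<noteq> 0" using assms by simp
  have "integrable lborel (\<lambda>t. sqrt (2 * pi) * std_normal_density t)"
    by (intro integrable_mult_right integrable_normal_density) simp
  hence "integrable lborel (\<lambda>x::real. exp (- x\<^sup>2 / 2))"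
    by (simp add: std_normal_density_def)
  from lborel_integrable_real_affine[OF this s, of 0]
  show "integrable lborel (\<lambda>t::real. exp (- \<epsilon> * t\<^sup>2 / 2))"
    using assms by (simp add: power_mult_distrib)
  have "complex_of_real (exp (- (- a / sqrt \<epsilon>)\<^sup>2 / 2)) = char std_normal_distribution (- a / sqrt \<epsilon>)"
    by (simp add: char_std_normal_distribution)
  also have "\<dots> = (LINT x|lborel. std_normal_density x *\<^sub>R cis ((- a / sqrt \<epsilon>) * x))"
    unfolding char_def by (subst integral_density) (auto simp: cis_conv_exp mult.commute)
  also have "\<dots> = sqrt \<epsilon> *\<^sub>R (LINT t|lborel. std_normal_density (sqrt \<epsilon> * t) *\<^sub>R cis ((- a / sqrt \<epsilon>) * (sqrt \<epsilon> * t)))"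
    using assms by (subst lborel_integral_real_affine[OF s, of _ 0]) simp
  also have "(\<lambda>t. std_normal_density (sqrt \<epsilon> * t) *\<^sub>R cis ((- a / sqrt \<epsilon>) * (sqrt \<epsilon> * t)))
     = (\<lambda>t. (1 / sqrt (2 * pi)) *\<^sub>R (cis (- (a * t)) * complex_of_real (exp (- \<epsilon> * t\<^sup>2 / 2))))"
    using assms by (auto simp: fun_eq_iff std_normal_density_def power_mult_distrib scaleR_conv_of_real)
  also have "sqrt \<epsilon> *\<^sub>R (LINT t|lborel. (1 / sqrt (2 * pi)) *\<^sub>R (cis (- (a * t)) * complex_of_real (exp (- \<epsilon> * t\<^sup>2 / 2))))
    = (sqrt \<epsilon> / sqrt (2 * pi)) *\<^sub>R (LINT t|lborel. cis (- (a * t)) * complex_of_real (exp (- \<epsilon> * t\<^sup>2 / 2)))"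
    by (subst integral_scaleR_right) simp_all
  finally have "sqrt (2 * pi / \<epsilon>) *\<^sub>R complex_of_real (exp (- (- a / sqrt \<epsilon>)\<^sup>2 / 2))
    = (sqrt (2 * pi / \<epsilon>) * (sqrt \<epsilon> / sqrt (2 * pi))) *\<^sub>R
       (LINT t|lborel. cis (- (a * t)) * complex_of_real (exp (- \<epsilon> * t\<^sup>2 / 2)))"
    by simp
  moreover have "sqrt (2 * pi / \<epsilon>) * (sqrt \<epsilon> / sqrt (2 * pi)) = 1"
    using assms by (simp add: real_sqrt_divide)
  ultimately show "(LINT t|lborel. cis (- (a * t)) * complex_of_real (exp (- \<epsilon> * t\<^sup>2 / 2)))
           = complex_of_real (sqrt (2 * pi / \<epsilon>) * exp (- a\<^sup>2 / (2 * \<epsilon>)))"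
    using assms by (simp add: power_divide scaleR_conv_of_real mult_ac)
qed

lemma prod_cis: "finite A \<Longrightarrow> (\<Prod>b\<in>A. cis (f b)) = cis (\<Sum>b\<in>A. f b)"
  by (induction A rule: finite_induct) (simp_all add: cis_mult)

lemma norm_sq_eq_sum: "(norm (x::'a::euclidean_space))\<^sup>2 = (\<Sum>b\<in>Basis. (x \<bullet> b)\<^sup>2)"
  unfolding power2_norm_eq_inner by (subst euclidean_inner) (simp add: power2_eq_square)

text \<open>
  The integrand is a product over the coordinates, and Lebesgue measure is the image of a product
  measure, so the integral factors into one-dimensional ones.
\<close>

lemma gaussian_fourier:
  fixes z :: "'a::euclidean_space"
  assumes "\<epsilon> > 0"
  shows "integrable lborel (\<lambda>\<xi>::'a. exp (- \<epsilon> * (norm \<xi>)\<^sup>2 / 2))"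
    and "(LINT \<xi>|lborel. cis (- (z \<bullet> \<xi>)) * complex_of_real (exp (- \<epsilon> * (norm \<xi>)\<^sup>2 / 2)))
           = complex_of_real (sqrt (2 * pi / \<epsilon>) ^ DIM('a) * exp (- (norm z)\<^sup>2 / (2 * \<epsilon>)))"
proof -
  interpret product_sigma_finite "\<lambda>b::'a. lborel :: real measure" ..
  define F where "F z b t = cis (- ((z \<bullet> b) * t)) * complex_of_real (exp (- \<epsilon> * t\<^sup>2 / 2))" for z b :: 'a and t
  have intF: "integrable lborel (F z b)" for z b
  proof -
    have "integrable lborel (\<lambda>t. complex_of_real (exp (- \<epsilon> * t\<^sup>2 / 2)))"
      using gaussian_fourier_real(1)[OF assms] by (rule integrable_of_real)
    thus ?thesis unfolding F_def
      by (rule Bochner_Integration.integrable_bound) (auto simp: norm_mult)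
  qed
  have eq: "cis (- (z \<bullet> (\<Sum>b\<in>Basis. f b *\<^sub>R b))) * complex_of_real (exp (- \<epsilon> * (norm (\<Sum>b\<in>Basis. f b *\<^sub>R b :: 'a))\<^sup>2 / 2))
      = (\<Prod>b\<in>Basis. F z b (f b))" for z :: 'a and f
    unfolding F_def prod.distrib
    by (simp add: prod_cis inner_sum_right sum_negf mult.commute norm_sq_eq_sum
          exp_sum[symmetric] sum_distrib_left sum_divide_distrib flip: of_real_prod)
  have m: "(\<lambda>f. \<Sum>b\<in>Basis. f b *\<^sub>R b :: 'a) \<in> (\<Pi>\<^sub>M b\<in>Basis. lborel) \<rightarrow>\<^sub>M borel" by measurable
  have int: "integrable lborel (\<lambda>\<xi>::'a. cis (- (z \<bullet> \<xi>)) * complex_of_real (exp (- \<epsilon> * (norm \<xi>)\<^sup>2 / 2)))" for z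
  proof (subst lborel_eq, subst integrable_distr_eq[OF m])
    show "integrable (\<Pi>\<^sub>M b\<in>Basis. lborel) (\<lambda>f. cis (- (z \<bullet> (\<Sum>b\<in>Basis. f b *\<^sub>R b))) *
        complex_of_real (exp (- \<epsilon> * (norm (\<Sum>b\<in>Basis. f b *\<^sub>R b :: 'a))\<^sup>2 / 2)))"
      unfolding eq by (rule product_integrable_prod) (auto intro: intF)
  qed measurable
  have "integrable lborel (\<lambda>\<xi>::'a. complex_of_real (exp (- \<epsilon> * (norm \<xi>)\<^sup>2 / 2)))"
    using int[of 0] by simp
  thus "integrable lborel (\<lambda>\<xi>::'a. exp (- \<epsilon> * (norm \<xi>)\<^sup>2 / 2))"
    by (simp only: complex_of_real_integrable_eq)
  have "(LINT \<xi>|lborel. cis (- (z \<bullet> \<xi>)) * complex_of_real (exp (- \<epsilon> * (norm \<xi>)\<^sup>2 / 2)))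
     = integral\<^sup>L (\<Pi>\<^sub>M b\<in>Basis. lborel) (\<lambda>f. \<Prod>b\<in>Basis. F z b (f b))"
    unfolding eq[symmetric] by (subst lborel_eq, subst integral_distr[OF m]) simp_all
  also have "\<dots> = (\<Prod>b\<in>Basis. LINT t|lborel. F z b t)"
    by (rule product_integral_prod) (auto intro: intF)
  also have "\<dots> = (\<Prod>b\<in>Basis. complex_of_real (sqrt (2 * pi / \<epsilon>) * exp (- (z \<bullet> b)\<^sup>2 / (2 * \<epsilon>))))"
    unfolding F_def by (intro prod.cong refl gaussian_fourier_real(2)[OF assms])
  also have "\<dots> = complex_of_real (sqrt (2 * pi / \<epsilon>) ^ DIM('a) * exp (- (norm z)\<^sup>2 / (2 * \<epsilon>)))"
    by (simp add: prod.distrib norm_sq_eq_sum exp_sum[symmetric] sum_negf sum_divide_distrib flip: of_real_prod)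
  finally show "(LINT \<xi>|lborel. cis (- (z \<bullet> \<xi>)) * complex_of_real (exp (- \<epsilon> * (norm \<xi>)\<^sup>2 / 2)))
           = complex_of_real (sqrt (2 * pi / \<epsilon>) ^ DIM('a) * exp (- (norm z)\<^sup>2 / (2 * \<epsilon>)))" .
qed

text \<open>
  The density of the centred normal distribution whose covariance matrix is \<open>\<epsilon>\<close> times the identity.
\<close>

definition heat :: "real \<Rightarrow> 'a::euclidean_space \<Rightarrow> real" where
  "heat \<epsilon> z = exp (- (norm z)\<^sup>2 / (2 * \<epsilon>)) / sqrt (2 * pi * \<epsilon>) ^ DIM('a)"

lemma heat_nonneg: "\<epsilon> > 0 \<Longrightarrow> heat \<epsilon> z \<ge> 0"
  by (simp add: heat_def)

lemma heat_minus: "heat \<epsilon> (- z) = heat \<epsilon> z"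
  by (simp add: heat_def)

lemma heat_measurable [measurable]: "heat \<epsilon> \<in> borel_measurable borel"
  unfolding heat_def[abs_def] by measurable

lemma heat_integrable:
  assumes "\<epsilon> > 0"
  shows "integrable lborel (heat \<epsilon> :: 'a::euclidean_space \<Rightarrow> real)"
    and "(LINT z|lborel. heat \<epsilon> (z::'a)) = 1"
proof -
  have e: "1 / \<epsilon> > 0" using assms by simp
  have heat: "heat \<epsilon> = (\<lambda>z::'a. exp (- (1 / \<epsilon>) * (norm z)\<^sup>2 / 2) / sqrt (2 * pi * \<epsilon>) ^ DIM('a))"
    by (simp add: heat_def fun_eq_iff mult.commute)
  show "integrable lborel (heat \<epsilon> :: 'a \<Rightarrow> real)"
    unfolding heat using gaussian_fourier(1)[OF e] by (rule integrable_divide)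
  have "complex_of_real (LINT z|lborel. exp (- (1 / \<epsilon>) * (norm (z::'a))\<^sup>2 / 2)) = complex_of_real (sqrt (2 * pi * \<epsilon>) ^ DIM('a))"
    using gaussian_fourier(2)[OF e, of "0::'a"] assms by (simp flip: integral_complex_of_real)
  hence "(LINT z|lborel. exp (- (1 / \<epsilon>) * (norm (z::'a))\<^sup>2 / 2)) = sqrt (2 * pi * \<epsilon>) ^ DIM('a)"
    by (simp only: of_real_eq_iff)
  thus "(LINT z|lborel. heat \<epsilon> (z::'a)) = 1"
    unfolding heat using assms by simp
qed

lemma nn_integral_lborel_reflect_translate:
  fixes h :: "'a::euclidean_space \<Rightarrow> ennreal"
  assumes [measurable]: "h \<in> borel_measurable borel"
  shows "(\<integral>\<^sup>+y. h (x - y) \<partial>lborel) = (\<integral>\<^sup>+y. h y \<partial>lborel)"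
  by (subst (2) lborel_affine[of "-1" x])
     (simp_all add: nn_integral_density nn_integral_distr)

lemma nn_integral_heat:
  fixes x :: "'a::euclidean_space"
  assumes "\<epsilon> > 0"
  shows "(\<integral>\<^sup>+y. ennreal (heat \<epsilon> (x - y)) \<partial>lborel) = 1"
    and "(\<integral>\<^sup>+y. ennreal (heat \<epsilon> (y - x)) \<partial>lborel) = 1"
proof -
  have "(\<integral>\<^sup>+y. ennreal (heat \<epsilon> (y::'a)) \<partial>lborel) = ennreal (LINT y|lborel. heat \<epsilon> (y::'a))"
    using assms by (intro nn_integral_eq_integral heat_integrable) (auto simp: heat_nonneg)
  thus "(\<integral>\<^sup>+y. ennreal (heat \<epsilon> (x - y)) \<partial>lborel) = 1"
    using nn_integral_lborel_reflect_translate[of "\<lambda>z. ennreal (heat \<epsilon> z)" x] heat_integrable(2)[OF assms, where 'a='a]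
    by simp
  thus "(\<integral>\<^sup>+y. ennreal (heat \<epsilon> (y - x)) \<partial>lborel) = 1"
    using heat_minus[of \<epsilon> "x - _"] by simp
qed

section \<open>Plancherel for integrable functions\<close>

lemma borel_measurable_cnj [measurable]: "cnj \<in> borel_measurable borel"
  by (intro borel_measurable_continuous_onI continuous_intros)

text \<open>
  The transform without normalising constant, over the Borel rather than the Lebesgue
  \<open>\<sigma>\<close>-algebra: Fubini's theorem and measurability of parameter integrals apply to the former.
\<close>

definition fourier_integral :: "('a::euclidean_space \<Rightarrow> complex) \<Rightarrow> 'a \<Rightarrow> complex" where
  "fourier_integral f \<xi> = (LINT x|lborel. f x * cis (- (x \<bullet> \<xi>)))"

lemma fourier_integral_measurable:
  assumes [measurable]: "f \<in> borel_measurable borel"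
  shows "fourier_integral f \<in> borel_measurable borel"
  unfolding fourier_integral_def[abs_def] by measurable

lemma cmod_fourier_integral_le:
  assumes "integrable lborel f"
  shows "cmod (fourier_integral f \<xi>) \<le> (LINT x|lborel. cmod (f x))"
  using integral_norm_bound[of lborel "\<lambda>x. f x * cis (- (x \<bullet> \<xi>))"]
  by (simp add: fourier_integral_def norm_mult)

text \<open>
  Expanding \<open>|F f|\<^sup>2\<close> gives the triple integral of \<open>f x * cnj (f y) * cis (- (x - y) \<bullet> \<xi>)\<close> over \<open>x\<close>, \<open>y\<close>
  and \<open>\<xi>\<close>. The weight makes it absolutely convergent, so that the integral over \<open>\<xi>\<close> may be
  carried out first, and this one is a Gaussian.
\<close>

lemma gaussian_plancherel:
  fixes f :: "'a::euclidean_space \<Rightarrow> complex"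
  assumes f: "integrable lborel f" and e: "\<epsilon> > 0"
  shows "integrable lborel (\<lambda>\<xi>. (cmod (fourier_integral f \<xi>))\<^sup>2 * exp (- \<epsilon> * (norm \<xi>)\<^sup>2 / 2))"
    and "integrable lborel (\<lambda>(x, y). f x * cnj (f y) * complex_of_real (heat \<epsilon> (x - y)))"
    and "complex_of_real (LINT \<xi>|lborel. (cmod (fourier_integral f \<xi>))\<^sup>2 * exp (- \<epsilon> * (norm \<xi>)\<^sup>2 / 2))
      = complex_of_real ((2 * pi) ^ DIM('a)) *
        (LINT p|lborel. (case p of (x, y) \<Rightarrow> f x * cnj (f y) * complex_of_real (heat \<epsilon> (x - y))))"
proof -
  have [measurable]: "f \<in> borel_measurable borel"
    using borel_measurable_integrable[OF f] by simp
  note [measurable] = fourier_integral_measurable[of f]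
  define w where "w \<xi> = exp (- \<epsilon> * (norm (\<xi>::'a))\<^sup>2 / 2)" for \<xi>
  have [measurable]: "w \<in> borel_measurable borel" unfolding w_def by measurable
  have w: "integrable lborel w" unfolding w_def by (rule gaussian_fourier(1)[OF e])
  define B where "B = (LINT x|lborel. cmod (f x))"
  have "(cmod (fourier_integral f \<xi>))\<^sup>2 \<le> B\<^sup>2" for \<xi>
    unfolding B_def by (intro power_mono cmod_fourier_integral_le f) simp
  hence "norm ((cmod (fourier_integral f \<xi>))\<^sup>2 * w \<xi>) \<le> norm (B\<^sup>2 * w \<xi>)" for \<xi>
    by (simp add: abs_mult w_def mult_right_mono)
  hence "integrable lborel (\<lambda>\<xi>. (cmod (fourier_integral f \<xi>))\<^sup>2 * w \<xi>)"
    by (intro Bochner_Integration.integrable_bound[OF integrable_mult_right[OF w, of "B\<^sup>2"]]) auto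
  thus "integrable lborel (\<lambda>\<xi>. (cmod (fourier_integral f \<xi>))\<^sup>2 * exp (- \<epsilon> * (norm \<xi>)\<^sup>2 / 2))"
    by (simp add: w_def)
  define G where "G p = (case p of (x, y) \<Rightarrow> f x * cnj (f y))" for p :: "'a \<times> 'a"
  have [measurable]: "G \<in> borel_measurable borel"
    unfolding G_def borel_prod[symmetric] by measurable
  have G: "integrable lborel G"
    using integrable_prod_mult[OF f, of "\<lambda>y. cnj (f y)"] f unfolding G_def lborel_prod by simp
  have heat_bound: "norm (complex_of_real (heat \<epsilon> z)) \<le> 1 / sqrt (2 * pi * \<epsilon>) ^ DIM('a)" for z :: 'a
    using heat_nonneg[OF e, of z] e
    by (simp only: norm_of_real abs_of_nonneg) (auto simp: heat_def intro!: divide_right_mono)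
  have [measurable]: "(\<lambda>p. heat \<epsilon> (fst p - snd p)) \<in> borel_measurable (borel :: ('a \<times> 'a) measure)"
    unfolding borel_prod[symmetric] by measurable
  have "integrable lborel (\<lambda>p. G p * complex_of_real (heat \<epsilon> (fst p - snd p)))"
  proof (rule Bochner_Integration.integrable_bound[OF integrable_mult_right[OF G, of "complex_of_real (1 / sqrt (2 * pi * \<epsilon>) ^ DIM('a))"]])
    show "AE p in lborel. norm (G p * complex_of_real (heat \<epsilon> (fst p - snd p)))
       \<le> norm (complex_of_real (1 / sqrt (2 * pi * \<epsilon>) ^ DIM('a)) * G p)"
    proof (intro AE_I2)
      fix p
      have "norm (G p * complex_of_real (heat \<epsilon> (fst p - snd p))) \<le> norm (G p) * (1 / sqrt (2 * pi * \<epsilon>) ^ DIM('a))"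
        unfolding norm_mult by (intro mult_left_mono heat_bound) simp
      thus "norm (G p * complex_of_real (heat \<epsilon> (fst p - snd p))) \<le> norm (complex_of_real (1 / sqrt (2 * pi * \<epsilon>) ^ DIM('a)) * G p)"
        using e by (simp add: norm_mult norm_divide norm_power mult.commute)
    qed
  qed measurable
  thus "integrable lborel (\<lambda>(x, y). f x * cnj (f y) * complex_of_real (heat \<epsilon> (x - y)))"
    by (simp add: G_def case_prod_unfold)
  define D where "D p = fst p - snd p" for p :: "'a \<times> 'a"
  have [measurable]: "D \<in> borel_measurable borel"
    unfolding D_def borel_prod[symmetric] by measurable
  \<comment> \<open>The points \<open>x\<close> and \<open>y\<close> form one variable \<open>p\<close>, which leaves a single exchange of integrals.\<close>
  define H where "H p \<xi> = G p * complex_of_real (w \<xi>) * cis (- (D p \<bullet> \<xi>))" for p \<xi>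
  have [measurable]: "(\<lambda>(p, \<xi>). H p \<xi>) \<in> borel_measurable (lborel \<Otimes>\<^sub>M lborel)"
    unfolding H_def by measurable
  have "integrable (lborel \<Otimes>\<^sub>M lborel) (\<lambda>(p, \<xi>). G p * complex_of_real (w \<xi>))"
    by (rule integrable_prod_mult[OF G]) (intro integrable_of_real w)
  hence H: "integrable (lborel \<Otimes>\<^sub>M lborel) (\<lambda>(p, \<xi>). H p \<xi>)"
    by (rule Bochner_Integration.integrable_bound) (auto simp: H_def norm_mult)
  have inner1: "(LINT p|lborel. H p \<xi>) = complex_of_real ((cmod (fourier_integral f \<xi>))\<^sup>2 * w \<xi>)" for \<xi>
  proof -
    \<comment> \<open>For fixed \<open>\<xi>\<close> the integrand separates into a function of \<open>x\<close> and its conjugate at \<open>y\<close>.\<close>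
    define a where "a x = f x * cis (- (x \<bullet> \<xi>))" for x
    have [measurable]: "a \<in> borel_measurable borel" unfolding a_def by measurable
    have a: "integrable lborel a"
      by (rule Bochner_Integration.integrable_bound[OF f]) (auto simp: a_def norm_mult)
    have int: "integrable (lborel \<Otimes>\<^sub>M lborel) (\<lambda>(x, y). a x * cnj (a y))"
      using integrable_prod_mult[OF a, of "\<lambda>y. cnj (a y)"] a by simp
    have "H p \<xi> = complex_of_real (w \<xi>) * (case p of (x, y) \<Rightarrow> a x * cnj (a y))" for p
      by (cases p) (simp add: H_def G_def D_def a_def cis_cnj cis_mult inner_diff_left algebra_simps)
    hence "(LINT p|lborel. H p \<xi>) = complex_of_real (w \<xi>) * integral\<^sup>L (lborel \<Otimes>\<^sub>M lborel) (\<lambda>(x, y). a x * cnj (a y))"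
      by (simp add: lborel_prod)
    also have "integral\<^sup>L (lborel \<Otimes>\<^sub>M lborel) (\<lambda>(x, y). a x * cnj (a y)) = (LINT x|lborel. LINT y|lborel. a x * cnj (a y))"
      by (rule lborel_pair.integral_fst[OF int, symmetric])
    also have "\<dots> = fourier_integral f \<xi> * cnj (fourier_integral f \<xi>)"
      by (simp add: fourier_integral_def a_def[symmetric])
    finally show ?thesis by (simp add: complex_norm_square[symmetric] mult.commute)
  qed
  have inner2: "(LINT \<xi>|lborel. H p \<xi>) = complex_of_real ((2 * pi) ^ DIM('a)) * (G p * complex_of_real (heat \<epsilon> (fst p - snd p)))" for p
  proof -
    have "(LINT \<xi>|lborel. H p \<xi>) = G p * (LINT \<xi>|lborel. cis (- ((fst p - snd p) \<bullet> \<xi>)) * complex_of_real (exp (- \<epsilon> * (norm \<xi>)\<^sup>2 / 2)))"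
      unfolding H_def D_def w_def by (subst integral_mult_right_zero[symmetric]) (simp only: mult_ac)
    also have "\<dots> = G p * complex_of_real (sqrt (2 * pi / \<epsilon>) ^ DIM('a) * exp (- (norm (fst p - snd p))\<^sup>2 / (2 * \<epsilon>)))"
      by (subst gaussian_fourier(2)[OF e]) simp
    also have "sqrt (2 * pi / \<epsilon>) ^ DIM('a) = (2 * pi) ^ DIM('a) / sqrt (2 * pi * \<epsilon>) ^ DIM('a)"
    proof -
      have "sqrt (2 * pi / \<epsilon>) = 2 * pi / sqrt (2 * pi * \<epsilon>)"
        using e by (simp add: real_sqrt_divide real_sqrt_mult field_simps)
      thus ?thesis by (simp add: power_divide)
    qed
    finally show ?thesis by (simp add: heat_def)
  qed
  have "complex_of_real (LINT \<xi>|lborel. (cmod (fourier_integral f \<xi>))\<^sup>2 * w \<xi>) = (LINT \<xi>|lborel. LINT p|lborel. H p \<xi>)"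
    unfolding inner1 by (rule integral_complex_of_real[symmetric])
  also have "\<dots> = (LINT p|lborel. LINT \<xi>|lborel. H p \<xi>)"
    by (rule lborel_pair.Fubini_integral[OF H])
  also have "\<dots> = complex_of_real ((2 * pi) ^ DIM('a)) * (LINT p|lborel. G p * complex_of_real (heat \<epsilon> (fst p - snd p)))"
    unfolding inner2 by (rule integral_mult_right_zero)
  finally show "complex_of_real (LINT \<xi>|lborel. (cmod (fourier_integral f \<xi>))\<^sup>2 * exp (- \<epsilon> * (norm \<xi>)\<^sup>2 / 2))
      = complex_of_real ((2 * pi) ^ DIM('a)) *
        (LINT p|lborel. (case p of (x, y) \<Rightarrow> f x * cnj (f y) * complex_of_real (heat \<epsilon> (x - y))))"
    unfolding w_def by (simp add: G_def case_prod_unfold)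
qed

text \<open>
  The Schur test: \<open>|f x| |f y| \<le> (|f x|\<^sup>2 + |f y|\<^sup>2) / 2\<close>, and the kernel has total mass \<open>1\<close> in each
  variable.
\<close>

lemma heat_autocorrelation_le:
  fixes f :: "'a::euclidean_space \<Rightarrow> complex"
  assumes [measurable]: "f \<in> borel_measurable borel" and e: "\<epsilon> > 0"
  shows "(\<integral>\<^sup>+p. (case p of (x, y) \<Rightarrow> ennreal (cmod (f x) * cmod (f y) * heat \<epsilon> (x - y))) \<partial>lborel)
           \<le> sqnorm lborel f"
proof -
  let ?q = "\<lambda>x. ennreal ((cmod (f x))\<^sup>2)"
  let ?h = "\<lambda>x y. ennreal (heat \<epsilon> (x - y))"
  have half: "ennreal (1/2) * (a + a) = a" for a :: ennreal
  proof -
    have "ennreal (1/2) * ennreal 2 = 1" by (subst ennreal_mult[symmetric]) simp_all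
    hence "(ennreal (1/2) * 2) * a = a" by simp
    thus ?thesis by (simp only: mult_2 mult.assoc)
  qed
  have "(\<integral>\<^sup>+p. (case p of (x, y) \<Rightarrow> ennreal (cmod (f x) * cmod (f y) * heat \<epsilon> (x - y))) \<partial>lborel)
     \<le> (\<integral>\<^sup>+p. (case p of (x, y) \<Rightarrow> ennreal (1/2) * (?q x * ?h x y + ?q y * ?h x y)) \<partial>(lborel \<Otimes>\<^sub>M lborel))"
    unfolding lborel_prod
  proof (intro nn_integral_mono, clarify)
    fix x y :: 'a
    have "cmod (f x) * cmod (f y) \<le> 1/2 * ((cmod (f x))\<^sup>2 + (cmod (f y))\<^sup>2)"
      using sum_squares_bound[of "cmod (f x)" "cmod (f y)"] by simp
    hence "cmod (f x) * cmod (f y) * heat \<epsilon> (x - y)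
      \<le> 1/2 * ((cmod (f x))\<^sup>2 + (cmod (f y))\<^sup>2) * heat \<epsilon> (x - y)"
      by (rule mult_right_mono) (rule heat_nonneg[OF e])
    hence "ennreal (cmod (f x) * cmod (f y) * heat \<epsilon> (x - y))
      \<le> ennreal (1/2 * ((cmod (f x))\<^sup>2 * heat \<epsilon> (x - y) + (cmod (f y))\<^sup>2 * heat \<epsilon> (x - y)))"
      by (intro ennreal_leI) (simp add: algebra_simps)
    also have "\<dots> = ennreal (1/2) * (?q x * ?h x y + ?q y * ?h x y)"
      using heat_nonneg[OF e, of "x - y"]
      by (subst ennreal_mult, simp, simp, subst ennreal_plus, simp, simp) (simp add: ennreal_mult)
    finally show "ennreal (cmod (f x) * cmod (f y) * heat \<epsilon> (x - y)) \<le> ennreal (1/2) * (?q x * ?h x y + ?q y * ?h x y)" .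
  qed
  also have "\<dots> = ennreal (1/2) * ((\<integral>\<^sup>+p. (case p of (x, y) \<Rightarrow> ?q x * ?h x y) \<partial>(lborel \<Otimes>\<^sub>M lborel))
      + (\<integral>\<^sup>+p. (case p of (x, y) \<Rightarrow> ?q y * ?h x y) \<partial>(lborel \<Otimes>\<^sub>M lborel)))"
    by (subst nn_integral_add[symmetric], measurable, subst nn_integral_cmult[symmetric], measurable)
       (simp add: case_prod_unfold)
  also have "(\<integral>\<^sup>+p. (case p of (x, y) \<Rightarrow> ?q x * ?h x y) \<partial>(lborel \<Otimes>\<^sub>M lborel)) = sqnorm lborel f"
    by (subst lborel.nn_integral_fst[symmetric])
       (simp_all add: nn_integral_cmult nn_integral_heat[OF e] sqnorm_def)
  also have "(\<integral>\<^sup>+p. (case p of (x, y) \<Rightarrow> ?q y * ?h x y) \<partial>(lborel \<Otimes>\<^sub>M lborel)) = sqnorm lborel f"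
    by (subst lborel_pair.nn_integral_snd[symmetric])
       (simp_all add: nn_integral_cmult nn_integral_heat[OF e] sqnorm_def)
  also have "ennreal (1/2) * (sqnorm lborel f + sqnorm lborel f) = sqnorm lborel f"
    by (rule half)
  finally show ?thesis .
qed

text \<open>
  The bound for the weighted integrals is uniform in the weight, and Fatou's lemma removes the weight.
\<close>

lemma bessel_fourier_integral:
  fixes f :: "'a::euclidean_space \<Rightarrow> complex"
  assumes f: "integrable lborel f"
  shows "sqnorm lborel (fourier_integral f) \<le> ennreal ((2 * pi) ^ DIM('a)) * sqnorm lborel f"
proof -
  have [measurable]: "f \<in> borel_measurable borel"
    using borel_measurable_integrable[OF f] by simp
  note [measurable] = fourier_integral_measurable[of f]
  define q where "q n \<xi> = (cmod (fourier_integral f \<xi>))\<^sup>2 * exp (- (1 / real (Suc n)) * (norm \<xi>)\<^sup>2 / 2)" for n \<xi>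
  have [measurable]: "q n \<in> borel_measurable borel" for n unfolding q_def by measurable
  have bound: "(\<integral>\<^sup>+\<xi>. ennreal (q n \<xi>) \<partial>lborel) \<le> ennreal ((2 * pi) ^ DIM('a)) * sqnorm lborel f" for n
  proof -
    have e: "1 / real (Suc n) > 0" by simp
    note * = gaussian_plancherel[OF f e]
    define I where "I = (LINT p|lborel. (case p of (x, y) \<Rightarrow> f x * cnj (f y) * complex_of_real (heat (1 / real (Suc n)) (x - y))))"
    have "(\<integral>\<^sup>+\<xi>. ennreal (q n \<xi>) \<partial>lborel) = ennreal (LINT \<xi>|lborel. q n \<xi>)"
      unfolding q_def by (intro nn_integral_eq_integral *(1)) simp
    also have "(LINT \<xi>|lborel. q n \<xi>) \<le> cmod (complex_of_real (LINT \<xi>|lborel. q n \<xi>))"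
      by simp
    also have "complex_of_real (LINT \<xi>|lborel. q n \<xi>) = complex_of_real ((2 * pi) ^ DIM('a)) * I"
      unfolding q_def I_def by (rule *(3))
    also have "ennreal (cmod \<dots>) = ennreal ((2 * pi) ^ DIM('a)) * ennreal (cmod I)"
      by (simp add: norm_mult norm_power ennreal_mult)
    also have "ennreal (cmod I) \<le> (\<integral>\<^sup>+p. norm (case p of (x, y) \<Rightarrow> f x * cnj (f y) * complex_of_real (heat (1 / real (Suc n)) (x - y))) \<partial>lborel)"
      unfolding I_def by (rule integral_norm_bound_ennreal[OF *(2)])
    also have "\<dots> = (\<integral>\<^sup>+p. (case p of (x, y) \<Rightarrow> ennreal (cmod (f x) * cmod (f y) * heat (1 / real (Suc n)) (x - y))) \<partial>lborel)"
      using heat_nonneg[OF e, where 'a='a]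
      by (intro nn_integral_cong) (auto simp: norm_mult simp del: of_nat_Suc)
    also have "\<dots> \<le> sqnorm lborel f" by (rule heat_autocorrelation_le) (use e in simp_all)
    finally show ?thesis by (simp add: ennreal_leI mult_left_mono)
  qed
  have "sqnorm lborel (fourier_integral f) = (\<integral>\<^sup>+\<xi>. liminf (\<lambda>n. ennreal (q n \<xi>)) \<partial>lborel)"
    unfolding sqnorm_def
  proof (rule nn_integral_cong)
    fix \<xi> :: 'a
    have "(\<lambda>n. q n \<xi>) \<longlonglongrightarrow> (cmod (fourier_integral f \<xi>))\<^sup>2 * exp (- 0 * (norm \<xi>)\<^sup>2 / 2)"
      unfolding q_def by (intro tendsto_intros LIMSEQ_Suc[OF lim_1_over_n]) simp
    hence "(\<lambda>n. ennreal (q n \<xi>)) \<longlonglongrightarrow> ennreal ((cmod (fourier_integral f \<xi>))\<^sup>2)"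
      by (intro tendsto_ennrealI) simp
    hence "liminf (\<lambda>n. ennreal (q n \<xi>)) = ennreal ((cmod (fourier_integral f \<xi>))\<^sup>2)"
      by (rule lim_imp_Liminf[rotated]) simp
    thus "ennreal ((cmod (fourier_integral f \<xi>))\<^sup>2) = liminf (\<lambda>n. ennreal (q n \<xi>))" ..
  qed
  also have "\<dots> \<le> liminf (\<lambda>n. \<integral>\<^sup>+\<xi>. ennreal (q n \<xi>) \<partial>lborel)"
    by (rule nn_integral_liminf) measurable
  also have "\<dots> \<le> ennreal ((2 * pi) ^ DIM('a)) * sqnorm lborel f"
    by (intro Liminf_le always_eventually allI bound) simp
  finally show ?thesis .
qed

lemma heat_smoothing_scaled:
  fixes g :: "'a::euclidean_space \<Rightarrow> complex"
  assumes [measurable]: "g \<in> borel_measurable borel" and e: "\<epsilon> > 0"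
  shows "(LINT y|lborel. g y * complex_of_real (heat \<epsilon> (x - y)))
       = (LINT z|lborel. g (x - sqrt \<epsilon> *\<^sub>R z) * complex_of_real (heat 1 z))"
proof -
  have s: "- sqrt \<epsilon> \<noteq> 0" using e by simp
  have "(LINT y|lborel. g y * complex_of_real (heat \<epsilon> (x - y)))
      = (LINT z|lborel. (\<bar>- sqrt \<epsilon>\<bar> ^ DIM('a)) *\<^sub>R (g (x - sqrt \<epsilon> *\<^sub>R z) * complex_of_real (heat \<epsilon> (sqrt \<epsilon> *\<^sub>R z))))"
    by (subst lborel_affine[OF s, of x], subst integral_density) (simp_all add: integral_distr)
  also have "\<dots> = (LINT z|lborel. g (x - sqrt \<epsilon> *\<^sub>R z) * complex_of_real (heat 1 z))"
    using e by (intro Bochner_Integration.integral_cong refl)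
      (simp add: heat_def scaleR_conv_of_real power_mult_distrib real_sqrt_mult)
  finally show ?thesis .
qed

text \<open>
  For bounded continuous \<open>f\<close> the averages of \<open>f\<close> against a concentrating heat kernel converge to \<open>f\<close>
  pointwise and boundedly. By dominated convergence the autocorrelations in \<open>gaussian_plancherel\<close>
  tend to the squared norm of \<open>f\<close>, while each of them is bounded by the unweighted integral on the
  Fourier side.
\<close>

lemma plancherel_bounded_continuous:
  fixes f :: "'a::euclidean_space \<Rightarrow> complex"
  assumes f: "integrable lborel f" and cont: "continuous_on UNIV f" and B: "\<And>x. cmod (f x) \<le> B"
  shows "ennreal ((2 * pi) ^ DIM('a)) * sqnorm lborel f \<le> sqnorm lborel (fourier_integral f)"
proof -
  have [measurable]: "f \<in> borel_measurable borel"
    using borel_measurable_integrable[OF f] by simp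
  note [measurable] = fourier_integral_measurable[of f]
  have B0: "B \<ge> 0" using B[of 0] norm_ge_zero order_trans by blast
  define \<epsilon> where "\<epsilon> n = 1 / real (Suc n)" for n
  have e: "\<epsilon> n > 0" for n by (simp add: \<epsilon>_def)
  have lim_e: "\<epsilon> \<longlonglongrightarrow> 0" unfolding \<epsilon>_def by (rule LIMSEQ_Suc[OF lim_1_over_n])
  define J where "J n x = (LINT z|lborel. cnj (f (x - sqrt (\<epsilon> n) *\<^sub>R z)) * complex_of_real (heat 1 z))" for n x
  have [measurable]: "J n \<in> borel_measurable borel" for n unfolding J_def by measurable
  have [simp]: "heat 1 (z::'a) \<ge> 0" for z
    by (rule heat_nonneg) simp
  have J_bound: "cmod (J n x) \<le> B" for n x
  proof -
    have "cmod (J n x) \<le> (LINT z|lborel. cmod (cnj (f (x - sqrt (\<epsilon> n) *\<^sub>R z)) * complex_of_real (heat 1 z)))"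
      unfolding J_def by (rule integral_norm_bound)
    also have "\<dots> \<le> (LINT z|lborel. B * heat 1 (z::'a))"
    proof (rule integral_mono_AE')
      show "integrable lborel (\<lambda>z::'a. B * heat 1 z)"
        by (intro integrable_mult_right heat_integrable) simp
      show "AE z in lborel. cmod (cnj (f (x - sqrt (\<epsilon> n) *\<^sub>R z)) * complex_of_real (heat 1 z)) \<le> B * heat 1 z"
        using B by (auto simp: norm_mult intro!: mult_right_mono)
    qed (use B0 in simp)
    also have "\<dots> = B" by (simp add: heat_integrable)
    finally show ?thesis .
  qed
  have J_lim: "(\<lambda>n. J n x) \<longlonglongrightarrow> cnj (f x)" for x
  proof -
    have "(\<lambda>n. J n x) \<longlonglongrightarrow> (LINT z|lborel. cnj (f (x - sqrt 0 *\<^sub>R z)) * complex_of_real (heat 1 z))"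
      unfolding J_def
    proof (rule integral_dominated_convergence[where w = "\<lambda>z. B * heat 1 z"])
      show "integrable lborel (\<lambda>z::'a. B * heat 1 z)"
        by (intro integrable_mult_right heat_integrable) simp
      show "AE z in lborel. (\<lambda>n. cnj (f (x - sqrt (\<epsilon> n) *\<^sub>R z)) * complex_of_real (heat 1 z))
          \<longlonglongrightarrow> cnj (f (x - sqrt 0 *\<^sub>R z)) * complex_of_real (heat 1 z)"
      proof (intro AE_I2 tendsto_intros)
        fix z
        have "(\<lambda>n. x - sqrt (\<epsilon> n) *\<^sub>R z) \<longlonglongrightarrow> x - sqrt 0 *\<^sub>R z"
          by (intro tendsto_intros lim_e)
        thus "(\<lambda>n. f (x - sqrt (\<epsilon> n) *\<^sub>R z)) \<longlonglongrightarrow> f (x - sqrt 0 *\<^sub>R z)"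
          using cont by (intro isCont_tendsto_compose[of _ f]) (auto simp: continuous_on_eq_continuous_at)
      qed
      show "AE z in lborel. norm (cnj (f (x - sqrt (\<epsilon> n) *\<^sub>R z)) * complex_of_real (heat 1 z)) \<le> B * heat 1 z" for n
        using B by (auto simp: norm_mult intro!: mult_right_mono)
    qed measurable
    also have "(LINT z|lborel. cnj (f (x - sqrt 0 *\<^sub>R z)) * complex_of_real (heat 1 z)) = cnj (f x)"
      by (simp add: heat_integrable)
    finally show ?thesis .
  qed
  define I where "I n = (LINT x|lborel. f x * J n x)" for n
  have I_lim: "I \<longlonglongrightarrow> (LINT x|lborel. f x * cnj (f x))"
    unfolding I_def
  proof (rule integral_dominated_convergence[where w = "\<lambda>x. cmod (f x) * B"])
    show "integrable lborel (\<lambda>x. cmod (f x) * B)"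
      using f by (intro integrable_mult_left integrable_norm)
    show "AE x in lborel. norm (f x * J n x) \<le> cmod (f x) * B" for n
      using J_bound by (auto simp: norm_mult mult_left_mono)
    show "AE x in lborel. (\<lambda>n. f x * J n x) \<longlonglongrightarrow> f x * cnj (f x)"
      by (intro AE_I2 tendsto_intros J_lim)
  qed measurable
  have sq_int: "integrable lborel (\<lambda>x. (cmod (f x))\<^sup>2)"
    by (rule Bochner_Integration.integrable_bound[OF integrable_mult_left[OF integrable_norm[OF f], of B]])
       (use B B0 in \<open>auto simp: power2_eq_square mult_left_mono\<close>)
  have norm_f: "sqnorm lborel f = ennreal (LINT x|lborel. (cmod (f x))\<^sup>2)"
    unfolding sqnorm_def by (rule nn_integral_eq_integral[OF sq_int]) simp
  have "(\<lambda>n. Re (complex_of_real ((2 * pi) ^ DIM('a)) * I n)) \<longlonglongrightarrow> Re (complex_of_real ((2 * pi) ^ DIM('a)) * (LINT x|lborel. f x * cnj (f x)))"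
    by (intro tendsto_intros I_lim)
  also have "(LINT x|lborel. f x * cnj (f x)) = complex_of_real (LINT x|lborel. (cmod (f x))\<^sup>2)"
    by (simp add: complex_norm_square[symmetric] flip: integral_complex_of_real)
  finally have lim: "(\<lambda>n. Re (complex_of_real ((2 * pi) ^ DIM('a)) * I n)) \<longlonglongrightarrow> (2 * pi) ^ DIM('a) * (LINT x|lborel. (cmod (f x))\<^sup>2)"
    by (simp flip: of_real_mult)
  have le: "ennreal (Re (complex_of_real ((2 * pi) ^ DIM('a)) * I n)) \<le> sqnorm lborel (fourier_integral f)" for n
  proof -
    note * = gaussian_plancherel[OF f e[of n]]
    have "(LINT p|lborel. (case p of (x, y) \<Rightarrow> f x * cnj (f y) * complex_of_real (heat (\<epsilon> n) (x - y))))
        = (LINT x|lborel. LINT y|lborel. f x * cnj (f y) * complex_of_real (heat (\<epsilon> n) (x - y)))"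
      using lborel_pair.integral_fst[OF *(2)[folded lborel_prod]] by (simp add: lborel_prod)
    also have "\<dots> = I n"
      unfolding I_def J_def by (subst heat_smoothing_scaled[symmetric]) (simp_all add: e mult.assoc)
    finally have "complex_of_real ((2 * pi) ^ DIM('a)) * I n
       = complex_of_real (LINT \<xi>|lborel. (cmod (fourier_integral f \<xi>))\<^sup>2 * exp (- \<epsilon> n * (norm \<xi>)\<^sup>2 / 2))"
      using *(3) by simp
    hence "ennreal (Re (complex_of_real ((2 * pi) ^ DIM('a)) * I n))
       = ennreal (LINT \<xi>|lborel. (cmod (fourier_integral f \<xi>))\<^sup>2 * exp (- \<epsilon> n * (norm \<xi>)\<^sup>2 / 2))"
      by simp
    also have "\<dots> = (\<integral>\<^sup>+\<xi>. ennreal ((cmod (fourier_integral f \<xi>))\<^sup>2 * exp (- \<epsilon> n * (norm \<xi>)\<^sup>2 / 2)) \<partial>lborel)"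
      by (intro nn_integral_eq_integral[symmetric] *(1)) simp
    also have "\<dots> \<le> sqnorm lborel (fourier_integral f)"
      unfolding sqnorm_def using e[of n] by (intro nn_integral_mono ennreal_leI mult_left_le) simp_all
    finally show ?thesis .
  qed
  have "ennreal ((2 * pi) ^ DIM('a) * (LINT x|lborel. (cmod (f x))\<^sup>2)) \<le> sqnorm lborel (fourier_integral f)"
    by (rule LIMSEQ_le_const2[OF tendsto_ennrealI[OF lim]]) (use le in blast)
  thus ?thesis by (simp add: norm_f ennreal_mult)
qed

section \<open>Translations, truncations and density in mean square\<close>

lemma cball_sets_lebesgue [measurable, simp]: "cball (a :: 'a::euclidean_space) r \<in> sets lebesgue"
  using lmeasurable_cball by (rule fmeasurableD)

lemma lebesgue_distr_translate_reflect:
  fixes t :: "'a::euclidean_space"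
  assumes "c = 1 \<or> c = -1"
  shows "distr lebesgue lebesgue (\<lambda>x. t + c *\<^sub>R x) = lebesgue"
    and "(\<lambda>x. t + c *\<^sub>R x) \<in> lebesgue \<rightarrow>\<^sub>M lebesgue"
proof -
  have c: "c \<noteq> 0" and c1: "\<bar>c\<bar> = 1" using assms by auto
  have eq: "(\<lambda>x::'a. t + (\<Sum>j\<in>Basis. (c * (x \<bullet> j)) *\<^sub>R j)) = (\<lambda>x. t + c *\<^sub>R x)"
    by (simp add: scaleR_scaleR[symmetric] scaleR_sum_right[symmetric] euclidean_representation del: scaleR_scaleR)
  show "(\<lambda>x. t + c *\<^sub>R x) \<in> lebesgue \<rightarrow>\<^sub>M lebesgue"
    using lebesgue_affine_measurable[of "\<lambda>_. c" t] c by (simp add: eq)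
  show "distr lebesgue lebesgue (\<lambda>x. t + c *\<^sub>R x) = lebesgue"
    using lebesgue_affine_euclidean[of "\<lambda>_. c" t] c c1 by (simp add: eq density_1)
qed

lemma
  fixes t :: "'a::euclidean_space"
  assumes c: "c = 1 \<or> c = -1"
  shows borel_measurable_lebesgue_affine:
      "f \<in> borel_measurable lebesgue \<Longrightarrow> (\<lambda>x. f (t + c *\<^sub>R x)) \<in> borel_measurable lebesgue"
    and sqnorm_lebesgue_affine:
      "g \<in> borel_measurable lebesgue \<Longrightarrow> sqnorm lebesgue (\<lambda>x. g (t + c *\<^sub>R x)) = sqnorm lebesgue g"
    and integrable_lebesgue_affine:
      "integrable lebesgue (h :: _ \<Rightarrow> complex) \<Longrightarrow> integrable lebesgue (\<lambda>x. h (t + c *\<^sub>R x))"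
    and integral_lebesgue_affine:
      "h \<in> borel_measurable lebesgue \<Longrightarrow> (LINT x|lebesgue. h (t + c *\<^sub>R x)) = (LINT x|lebesgue. h x)"
proof -
  note d = lebesgue_distr_translate_reflect(1)[OF c, of t]
    and m = lebesgue_distr_translate_reflect(2)[OF c, of t]
  show "f \<in> borel_measurable lebesgue \<Longrightarrow> (\<lambda>x. f (t + c *\<^sub>R x)) \<in> borel_measurable lebesgue"
    using measurable_compose[OF m] by blast
  show "sqnorm lebesgue (\<lambda>x. g (t + c *\<^sub>R x)) = sqnorm lebesgue g" if [measurable]: "g \<in> borel_measurable lebesgue"
    unfolding sqnorm_def by (subst (2) d[symmetric], subst nn_integral_distr[OF m]) simp_all
  show "integrable lebesgue (\<lambda>x. h (t + c *\<^sub>R x))" if "integrable lebesgue (h :: _ \<Rightarrow> complex)"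
    using that by (subst (asm) d[symmetric]) (rule integrable_distr[OF m])
  show "(LINT x|lebesgue. h (t + c *\<^sub>R x)) = (LINT x|lebesgue. h x)" if "h \<in> borel_measurable lebesgue"
    using that by (subst (2) d[symmetric], subst integral_distr[OF m]) simp_all
qed

text \<open>
  Lets functions that are only Lebesgue measurable enter the Borel statements about
  \<^const>\<open>fourier_integral\<close>.
\<close>

lemma borel_representative:
  fixes f :: "'a::euclidean_space \<Rightarrow> complex"
  assumes "f \<in> borel_measurable lebesgue"
  obtains g where "g \<in> borel_measurable borel" "AE x in lborel. f x = g x"
proof -
  have "(\<lambda>x. Re (f x)) \<in> borel_measurable lebesgue" "(\<lambda>x. Im (f x)) \<in> borel_measurable lebesgue"
    using assms by measurable
  from this[THEN completion_ex_borel_measurable_real]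
  obtain a b where ab: "a \<in> borel_measurable lborel" "b \<in> borel_measurable lborel"
    and a: "AE x in lborel. Re (f x) = a x" and b: "AE x in lborel. Im (f x) = b x"
    by blast
  have [measurable]: "a \<in> borel_measurable borel" "b \<in> borel_measurable borel"
    using ab by simp_all
  show ?thesis
  proof (rule that[of "\<lambda>x. Complex (a x) (b x)"])
    have "(\<lambda>x. complex_of_real (a x) + \<i> * complex_of_real (b x)) \<in> borel_measurable borel"
      by measurable
    thus "(\<lambda>x. Complex (a x) (b x)) \<in> borel_measurable borel" by (simp add: Complex_eq)
    show "AE x in lborel. f x = Complex (a x) (b x)"
      using a b by eventually_elim (simp add: complex_eq_iff)
  qed
qed

lemma sqnorm_lebesgue: "sqnorm lebesgue f = sqnorm lborel f"
  by (simp add: sqnorm_def nn_integral_completion)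

lemma square_integrable_iff:
  "square_integrable f \<longleftrightarrow> f \<in> borel_measurable lebesgue \<and> sqnorm lebesgue f < \<infinity>"
  unfolding square_integrable_def sqnorm_def integrable_iff_bounded by auto

lemma square_integrableD:
  assumes "square_integrable f"
  shows "f \<in> borel_measurable lebesgue" "sqnorm lebesgue f < \<infinity>"
  using assms by (simp_all add: square_integrable_iff)

lemma square_integrable_norm_eq:
  "square_integrable f \<Longrightarrow> sqnorm lebesgue f = ennreal (LINT x|lebesgue. (cmod (f x))\<^sup>2)"
  unfolding square_integrable_def sqnorm_def by (intro nn_integral_eq_integral) auto

lemma square_integrable_close:
  assumes "f \<in> borel_measurable lebesgue" "square_integrable g"
    and "sqnorm lebesgue (\<lambda>x. g x - f x) < \<infinity>"
  shows "square_integrable f"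
proof -
  note [measurable] = assms(1) square_integrableD(1)[OF assms(2)]
  have "sqnorm lebesgue f = sqnorm lebesgue (\<lambda>x. (f x - g x) + g x)" by simp
  also have "\<dots> \<le> 2 * sqnorm lebesgue (\<lambda>x. f x - g x) + 2 * sqnorm lebesgue g"
    by (rule sqnorm_add_le) measurable
  also have "\<dots> < \<infinity>"
    using assms(3) square_integrableD(2)[OF assms(2)]
    by (simp add: sqnorm_minus_commute[of _ f] ennreal_mult_less_top less_top)
  finally show ?thesis using assms(1) by (simp add: square_integrable_iff)
qed

lemma square_integrable_add:
  assumes "square_integrable f" "square_integrable g"
  shows "square_integrable (\<lambda>x. f x + g x)"
proof -
  note [measurable] = square_integrableD(1)[OF assms(1)] square_integrableD(1)[OF assms(2)]
  have "sqnorm lebesgue (\<lambda>x. f x + g x) \<le> 2 * sqnorm lebesgue f + 2 * sqnorm lebesgue g"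
    by (rule sqnorm_add_le) measurable
  also have "\<dots> < \<infinity>"
    using square_integrableD(2)[OF assms(1)] square_integrableD(2)[OF assms(2)]
    by (simp add: ennreal_mult_less_top less_top)
  finally show ?thesis by (simp add: square_integrable_iff)
qed

lemma square_integrable_bounded_mult:
  assumes "square_integrable f" and [measurable]: "c \<in> borel_measurable lebesgue"
    and "\<And>x. cmod (c x) \<le> B"
  shows "square_integrable (\<lambda>x. c x * f x)"
proof -
  note [measurable] = square_integrableD(1)[OF assms(1)]
  have "sqnorm lebesgue (\<lambda>x. c x * f x) \<le> sqnorm lebesgue (\<lambda>x. complex_of_real B * f x)"
    unfolding sqnorm_def using assms(3)
    by (intro nn_integral_mono ennreal_leI power_mono) (auto simp: norm_mult intro!: mult_right_mono order_trans[OF _ abs_ge_self])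
  also have "\<dots> < \<infinity>"
    using square_integrableD(2)[OF assms(1)] by (subst sqnorm_cmult) (simp_all add: ennreal_mult_less_top less_top)
  finally show ?thesis by (simp add: square_integrable_iff)
qed

lemma square_integrable_affine:
  assumes "square_integrable f" "c = 1 \<or> c = -1"
  shows "square_integrable (\<lambda>x. f (t + c *\<^sub>R x))"
  using assms sqnorm_lebesgue_affine[OF assms(2), of f t] borel_measurable_lebesgue_affine[OF assms(2), of f t]
  by (simp add: square_integrable_iff)

lemma bounded_on_ball_integrable:
  fixes h :: "real ^ 'n \<Rightarrow> complex"
  assumes [measurable]: "h \<in> borel_measurable lebesgue"
    and "\<And>x. cmod (h x) \<le> M" "\<And>x. x \<notin> cball 0 R \<Longrightarrow> h x = 0"
  shows "integrable lebesgue h" "square_integrable h"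
proof -
  have ball: "integrable lebesgue (\<lambda>x. K * indicat_real (cball 0 R :: (real ^ 'n) set) x)" for K
    using lmeasurable_cball[of "0 :: real ^ 'n" R] by (simp add: fmeasurable_def)
  have h: "cmod (h x) \<le> M * indicator (cball 0 R) x" for x
    using assms(2,3)[of x] by (auto simp: indicator_def)
  show "integrable lebesgue h"
    by (rule Bochner_Integration.integrable_bound[OF ball[of M]])
       (auto intro!: AE_I2 order_trans[OF h])
  have "(cmod (h x))\<^sup>2 \<le> M\<^sup>2 * indicator (cball 0 R) x" for x
    using assms(2,3)[of x] by (cases "x \<in> cball 0 R") (auto intro!: power_mono)
  hence "integrable lebesgue (\<lambda>x. (cmod (h x))\<^sup>2)"
    by (intro Bochner_Integration.integrable_bound[OF ball[of "M\<^sup>2"]]) auto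
  thus "square_integrable h" by (simp add: square_integrable_def)
qed

lemma sqnorm_dominated_convergence:
  assumes [measurable]: "\<And>n. h n \<in> borel_measurable M" "f \<in> borel_measurable M" "w \<in> borel_measurable M"
    and dom: "\<And>n x. cmod (h n x - f x) \<le> cmod (w x)" and w: "sqnorm M w < \<infinity>"
    and lim: "AE x in M. (\<lambda>n. h n x) \<longlonglongrightarrow> f x"
  shows "(\<lambda>n. sqnorm M (\<lambda>x. h n x - f x)) \<longlonglongrightarrow> 0"
proof -
  have "(\<lambda>n. sqnorm M (\<lambda>x. h n x - f x)) \<longlonglongrightarrow> (\<integral>\<^sup>+x. 0 \<partial>M)"
    unfolding sqnorm_def
  proof (rule nn_integral_dominated_convergence[where w = "\<lambda>x. ennreal ((cmod (w x))\<^sup>2)"])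
    show "(\<integral>\<^sup>+x. ennreal ((cmod (w x))\<^sup>2) \<partial>M) < \<infinity>" using w by (simp add: sqnorm_def)
    show "AE x in M. ennreal ((cmod (h n x - f x))\<^sup>2) \<le> ennreal ((cmod (w x))\<^sup>2)" for n
      using dom by (intro AE_I2 ennreal_leI power_mono) auto
    show "AE x in M. (\<lambda>n. ennreal ((cmod (h n x - f x))\<^sup>2)) \<longlonglongrightarrow> 0"
      using lim
    proof eventually_elim
      case (elim x)
      hence "(\<lambda>n. (cmod (h n x - f x))\<^sup>2) \<longlonglongrightarrow> (cmod (f x - f x))\<^sup>2" by (intro tendsto_intros)
      hence "(\<lambda>n. ennreal ((cmod (h n x - f x))\<^sup>2)) \<longlonglongrightarrow> ennreal ((cmod (f x - f x))\<^sup>2)"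
        by (rule tendsto_ennrealI)
      thus ?case by simp
    qed
  qed measurable
  thus ?thesis by simp
qed

lemma square_integrable_truncation:
  fixes f :: "real ^ 'n \<Rightarrow> complex"
  assumes "square_integrable f"
  shows "square_integrable (\<lambda>x. indicator (cball 0 R) x *\<^sub>R f x)"
    and "integrable lebesgue (\<lambda>x. indicator (cball 0 R) x *\<^sub>R f x)"
    and "(\<lambda>n. sqnorm lebesgue (\<lambda>x. indicator (cball 0 (real n)) x *\<^sub>R f x - f x)) \<longlonglongrightarrow> 0"
proof -
  note [measurable] = square_integrableD(1)[OF assms]
  have "(\<lambda>x. complex_of_real (indicator (cball 0 R) (x :: real ^ 'n))) \<in> borel_measurable lebesgue"
    by (simp add: borel_measurable_complex_iff borel_measurable_indicator)
  from square_integrable_bounded_mult[OF assms this, of 1]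
  show "square_integrable (\<lambda>x. indicator (cball 0 R) x *\<^sub>R f x)"
    by (simp add: scaleR_conv_of_real indicator_def)
  have "integrable lebesgue (indicat_real (cball 0 R :: (real ^ 'n) set))"
    using lmeasurable_cball[of "0 :: real ^ 'n" R] by (simp add: fmeasurable_def)
  moreover have "integrable lebesgue (\<lambda>x. (cmod (f x))\<^sup>2)"
    using assms by (simp add: square_integrable_def)
  ultimately have "integrable lebesgue (\<lambda>x. indicat_real (cball 0 R) x + (cmod (f x))\<^sup>2)"
    by (rule Bochner_Integration.integrable_add)
  thus "integrable lebesgue (\<lambda>x. indicator (cball 0 R) x *\<^sub>R f x)"
  proof (rule Bochner_Integration.integrable_bound)
    have "c \<le> 1 + c\<^sup>2" for c :: real
      using zero_le_power2[of "c - 1/2"] by (simp add: power2_diff power_divide)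
    thus "AE x in lebesgue. norm (indicator (cball 0 R) x *\<^sub>R f x) \<le> norm (indicat_real (cball 0 R) x + (cmod (f x))\<^sup>2)"
      by (auto simp: indicator_def)
  qed measurable
  show "(\<lambda>n. sqnorm lebesgue (\<lambda>x. indicator (cball 0 (real n)) x *\<^sub>R f x - f x)) \<longlonglongrightarrow> 0"
  proof (rule sqnorm_dominated_convergence[where w = f])
    show "AE x in lebesgue. (\<lambda>n. indicator (cball 0 (real n)) x *\<^sub>R f x) \<longlonglongrightarrow> f x"
    proof (intro AE_I2 tendsto_eventually)
      fix x :: "real ^ 'n"
      obtain N where "norm x \<le> real N" using real_arch_simple by blast
      thus "\<forall>\<^sub>F n in sequentially. indicator (cball 0 (real n)) x *\<^sub>R f x = f x"
        by (intro eventually_sequentiallyI[of N]) (auto simp: indicator_def)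
    qed
    show "cmod (indicator (cball 0 (real n)) x *\<^sub>R f x - f x) \<le> cmod (f x)" for n x
      by (auto simp: indicator_def)
  qed (use square_integrableD[OF assms] in auto)
qed

text \<open>
  A Lebesgue measurable function is an almost everywhere limit of continuous functions \<open>g n\<close>, over
  whose size nothing is known. Clamping the values and cutting off at infinity by
  continuous maps makes these bounded with bounded support, uniformly in \<open>n\<close>, and dominated
  convergence applies first in \<open>n\<close> and then in the truncation level.
\<close>

lemma bounded_continuous_approximation:
  fixes f :: "real ^ 'n \<Rightarrow> complex"
  assumes f: "square_integrable f" and e: "e > (0::ennreal)"
  shows "\<exists>h. continuous_on UNIV h \<and> bounded (range h) \<and> integrable lebesgue h \<and>
           square_integrable h \<and> sqnorm lebesgue (\<lambda>x. h x - f x) < e"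
proof -
  note [measurable] = square_integrableD(1)[OF f]
  have "f measurable_on UNIV"
    using square_integrableD(1)[OF f] by (intro lebesgue_measurable_imp_measurable_on) auto
  then obtain N g where N: "negligible N" and cont: "\<And>n. continuous_on UNIV (g n)"
    and lim: "\<And>x. x \<notin> N \<Longrightarrow> (\<lambda>n::nat. g n x) \<longlonglongrightarrow> f x"
    unfolding measurable_on_def by auto
  \<comment> \<open>\<open>\<kappa> m\<close> is a cutoff equal to \<open>1\<close> on the ball of radius \<open>m\<close>, and \<open>\<tau> m\<close> retracts the plane onto the
    disc of radius \<open>m + 1\<close>. The \<open>+ 1\<close> keeps this radius positive.\<close>
  define \<kappa> where "\<kappa> m x = max 0 (min 1 (real m + 1 - norm x))" for m and x :: "real ^ 'n"
  define \<tau> where "\<tau> m w = w / complex_of_real (max 1 (cmod w / (real m + 1)))" for m and w :: complex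
  define \<Phi> where "\<Phi> m u x = complex_of_real (\<kappa> m x) * \<tau> m (u x)" for m and u :: "real ^ 'n \<Rightarrow> complex" and x
  have \<kappa>: "0 \<le> \<kappa> m x" "\<kappa> m x \<le> 1" for m x by (auto simp: \<kappa>_def)
  have \<tau>_bound: "cmod (\<tau> m w) \<le> real m + 1" for m w
    by (auto simp: \<tau>_def norm_divide divide_simps max_def)
  have \<tau>_le: "cmod (\<tau> m w) \<le> cmod w" for m w
    by (auto simp: \<tau>_def norm_divide divide_simps max_def mult_left_mono)
  have \<tau>_cont: "continuous_on UNIV (\<tau> m)" for m
    unfolding \<tau>_def by (intro continuous_intros) (auto simp: max_def)
  have [measurable]: "\<tau> m \<in> borel_measurable borel" for m
    by (intro borel_measurable_continuous_onI \<tau>_cont)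
  have [measurable]: "\<kappa> m \<in> borel_measurable lebesgue" for m
    unfolding \<kappa>_def by (intro measurable_completion) measurable
  have [measurable]: "g n \<in> borel_measurable lebesgue" for n
    by (intro measurable_completion) (simp add: borel_measurable_continuous_onI cont)
  have \<Phi>_meas: "\<Phi> m u \<in> borel_measurable lebesgue" if [measurable]: "u \<in> borel_measurable lebesgue" for m u
    unfolding \<Phi>_def by measurable
  note [measurable] = \<Phi>_meas[OF square_integrableD(1)[OF f]] \<Phi>_meas[OF \<open>g _ \<in> borel_measurable lebesgue\<close>]
  have \<Phi>_bound: "cmod (\<Phi> m u x) \<le> real m + 1" for m u x
    using mult_mono[OF \<kappa>(2)[of m x] \<tau>_bound[of m "u x"]] \<kappa>(1)[of m x] by (simp add: \<Phi>_def norm_mult)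
  have \<Phi>_0: "\<Phi> m u x = 0" if "x \<notin> cball 0 (real m + 1)" for m u x
    using that by (simp add: \<Phi>_def \<kappa>_def)
  note \<Phi>_int = bounded_on_ball_integrable[OF \<Phi>_meas \<Phi>_bound \<Phi>_0]
  have step1: "(\<lambda>m. sqnorm lebesgue (\<lambda>x. \<Phi> m f x - f x)) \<longlonglongrightarrow> 0"
  proof (rule sqnorm_dominated_convergence[where w = "\<lambda>x. 2 * f x"])
    show "AE x in lebesgue. (\<lambda>m. \<Phi> m f x) \<longlonglongrightarrow> f x"
    proof (intro AE_I2 tendsto_eventually)
      fix x :: "real ^ 'n"
      obtain N where "max (norm x) (cmod (f x)) \<le> real N" using real_arch_simple by blast
      hence N: "norm x \<le> real N" "cmod (f x) \<le> real N" by simp_all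
      have "\<Phi> m f x = f x" if "m \<ge> N" for m
      proof -
        have le: "norm x \<le> real m" "cmod (f x) \<le> real m" using N that by linarith+
        hence "\<kappa> m x = 1" by (simp add: \<kappa>_def)
        moreover have "max 1 (cmod (f x) / (real m + 1)) = 1" using le by (simp add: max_def divide_simps)
        ultimately show ?thesis by (simp add: \<Phi>_def \<tau>_def)
      qed
      thus "\<forall>\<^sub>F m in sequentially. \<Phi> m f x = f x"
        by (rule eventually_sequentiallyI)
    qed
    show "cmod (\<Phi> m f x - f x) \<le> cmod (2 * f x)" for m x
    proof -
      have "cmod (\<Phi> m f x) \<le> 1 * cmod (f x)"
        using mult_mono[OF \<kappa>(2)[of m x] \<tau>_le[of m "f x"]] \<kappa>(1)[of m x] by (simp add: \<Phi>_def norm_mult)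
      thus ?thesis using norm_triangle_ineq4[of "\<Phi> m f x" "f x"] by (simp add: norm_mult)
    qed
    show "sqnorm lebesgue (\<lambda>x. 2 * f x) < \<infinity>"
      using square_integrableD(2)[OF f] by (subst sqnorm_cmult) (auto simp: ennreal_mult_less_top)
  qed measurable
  have step2: "(\<lambda>n. sqnorm lebesgue (\<lambda>x. \<Phi> m (g n) x - \<Phi> m f x)) \<longlonglongrightarrow> 0" for m
  proof (rule sqnorm_dominated_convergence[where w = "\<lambda>x. complex_of_real (2 * (real m + 1) * indicator (cball 0 (real m + 1)) x)"])
    show "sqnorm lebesgue (\<lambda>x::real^'n. complex_of_real (2 * (real m + 1) * indicator (cball 0 (real m + 1)) x)) < \<infinity>"
    proof (rule square_integrableD(2), rule bounded_on_ball_integrable(2))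
      show "cmod (complex_of_real (2 * (real m + 1) * indicator (cball 0 (real m + 1)) x)) \<le> 2 * (real m + 1)" for x :: "real ^ 'n"
        unfolding norm_of_real by (simp add: indicator_def)
      show "complex_of_real (2 * (real m + 1) * indicator (cball 0 (real m + 1)) x) = 0"
        if "x \<notin> cball 0 (real m + 1)" for x :: "real ^ 'n" using that by simp
    qed measurable
    show "cmod (\<Phi> m (g n) x - \<Phi> m f x) \<le> cmod (complex_of_real (2 * (real m + 1) * indicator (cball 0 (real m + 1)) x))" for n x
    proof (cases "x \<in> cball 0 (real m + 1)")
      case True
      have "cmod (\<Phi> m (g n) x - \<Phi> m f x) \<le> 2 * (real m + 1)"
        using norm_triangle_ineq4[of "\<Phi> m (g n) x" "\<Phi> m f x"] \<Phi>_bound[of m "g n" x] \<Phi>_bound[of m f x] by simp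
      thus ?thesis using True unfolding norm_of_real by simp
    qed (simp add: \<Phi>_0)
    have "AE x in lebesgue. x \<notin> N"
      using N by (intro AE_not_in) (simp add: negligible_iff_null_sets)
    thus "AE x in lebesgue. (\<lambda>n. \<Phi> m (g n) x) \<longlonglongrightarrow> \<Phi> m f x"
    proof eventually_elim
      case (elim x)
      have "(\<lambda>n. \<tau> m (g n x)) \<longlonglongrightarrow> \<tau> m (f x)"
        using \<tau>_cont[of m] lim[OF elim]
        by (intro isCont_tendsto_compose[of _ "\<tau> m"]) (auto simp: continuous_on_eq_continuous_at)
      thus ?case unfolding \<Phi>_def by (intro tendsto_intros)
    qed
  qed measurable
  \<comment> \<open>The two factors \<open>2\<close> come from the triangle inequality for squared norms.\<close>
  obtain \<delta> :: ennreal where \<delta>: "\<delta> > 0" "2 * \<delta> + 2 * \<delta> \<le> e"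
  proof (cases "e = \<infinity>")
    case True thus ?thesis by (intro that[of 1]) auto
  next
    case False
    then obtain r where r: "e = ennreal r" "r > 0" using e by (cases e) auto
    have two: "2 * ennreal (r/4) = ennreal (r/2)"
      using r by (subst ennreal_numeral[symmetric], subst ennreal_mult[symmetric]) simp_all
    have "2 * ennreal (r/4) + 2 * ennreal (r/4) = ennreal (r/2 + r/2)"
      unfolding two using r by (intro ennreal_plus[symmetric]) simp_all
    thus ?thesis using r by (intro that[of "ennreal (r/4)"]) auto
  qed
  obtain m where m: "sqnorm lebesgue (\<lambda>x. \<Phi> m f x - f x) < \<delta>"
    using order_tendstoD(2)[OF step1 \<delta>(1)] by (auto simp: eventually_sequentially)
  obtain n where n: "sqnorm lebesgue (\<lambda>x. \<Phi> m (g n) x - \<Phi> m f x) < \<delta>"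
    using order_tendstoD(2)[OF step2 \<delta>(1)] by (auto simp: eventually_sequentially)
  have "sqnorm lebesgue (\<lambda>x. \<Phi> m (g n) x - f x)
     \<le> 2 * sqnorm lebesgue (\<lambda>x. \<Phi> m (g n) x - \<Phi> m f x) + 2 * sqnorm lebesgue (\<lambda>x. \<Phi> m f x - f x)"
    by (rule sqnorm_diff_triangle) measurable
  also have "\<dots> < 2 * \<delta> + 2 * \<delta>"
    using m n by (intro add_strict_mono ennreal_mult_strict_left_mono) auto
  also have "\<dots> \<le> e" by (rule \<delta>)
  finally have "sqnorm lebesgue (\<lambda>x. \<Phi> m (g n) x - f x) < e" .
  moreover have "continuous_on UNIV (\<Phi> m (g n))"
    unfolding \<Phi>_def \<kappa>_def
    by (intro continuous_intros continuous_on_compose2[OF \<tau>_cont cont]) auto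
  moreover have "bounded (range (\<Phi> m (g n)))"
    using \<Phi>_bound by (auto simp: bounded_iff)
  moreover have "integrable lebesgue (\<Phi> m (g n))" "square_integrable (\<Phi> m (g n))"
    by (rule \<Phi>_int; measurable)+
  ultimately show ?thesis by (intro exI[of _ "\<Phi> m (g n)"] conjI)
qed

lemma bounded_continuous_dense:
  fixes f :: "real ^ 'n \<Rightarrow> complex"
  assumes "square_integrable f"
  obtains h where "\<And>n. continuous_on UNIV (h n)" "\<And>n. bounded (range (h n))"
    "\<And>n. integrable lebesgue (h n)" "\<And>n. square_integrable (h n)"
    "(\<lambda>n. sqnorm lebesgue (\<lambda>x. h n x - f x)) \<longlonglongrightarrow> 0"
proof -
  define Q where "Q n h \<longleftrightarrow> continuous_on UNIV h \<and> bounded (range h) \<and> integrable lebesgue h \<and>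
     square_integrable h \<and> sqnorm lebesgue (\<lambda>x. h x - f x) < ennreal (1 / real (Suc n))" for n h
  have "\<exists>h. Q n h" for n
    unfolding Q_def by (rule bounded_continuous_approximation[OF assms]) simp
  then obtain h where h: "\<And>n. Q n (h n)" by metis
  have "(\<lambda>n. ennreal (1 / real (Suc n))) \<longlonglongrightarrow> ennreal 0"
    by (intro tendsto_ennrealI LIMSEQ_Suc[OF lim_1_over_n])
  hence lim: "(\<lambda>n. ennreal (1 / real (Suc n))) \<longlonglongrightarrow> 0" by simp
  have "(\<lambda>n. sqnorm lebesgue (\<lambda>x. h n x - f x)) \<longlonglongrightarrow> 0"
  proof (rule tendsto_sandwich[OF _ _ tendsto_const lim])
    show "\<forall>\<^sub>F n in sequentially. sqnorm lebesgue (\<lambda>x. h n x - f x) \<le> ennreal (1 / real (Suc n))"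
      by (intro always_eventually allI less_imp_le) (use h in \<open>simp add: Q_def\<close>)
  qed simp
  thus ?thesis using h unfolding Q_def by (intro that[of h]) blast+
qed

section \<open>The Fourier--Plancherel transform\<close>

lemma fourier_L1_eq_fourier_integral:
  fixes f g :: "real ^ 'n \<Rightarrow> complex"
  assumes [measurable]: "f \<in> borel_measurable lebesgue" "g \<in> borel_measurable borel"
    and ae: "AE x in lborel. f x = g x"
  shows "fourier_L1 f = (\<lambda>\<xi>. complex_of_real ((2 * pi) powr (- real CARD('n) / 2)) * fourier_integral g \<xi>)"
proof
  fix \<xi> :: "real ^ 'n"
  have "(LINT x|lebesgue. f x * cis (- (x \<bullet> \<xi>))) = (LINT x|lebesgue. g x * cis (- (x \<bullet> \<xi>)))"
  proof (rule integral_cong_AE)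
    show "AE x in lebesgue. f x * cis (- (x \<bullet> \<xi>)) = g x * cis (- (x \<bullet> \<xi>))"
      using AE_completion[OF ae] by eventually_elim simp
    show "(\<lambda>x. g x * cis (- (x \<bullet> \<xi>))) \<in> borel_measurable lebesgue"
      by (intro measurable_completion) measurable
    have [measurable]: "(\<lambda>x. cis (- (x \<bullet> \<xi>))) \<in> borel_measurable lebesgue"
      by (intro measurable_completion) measurable
    show "(\<lambda>x. f x * cis (- (x \<bullet> \<xi>))) \<in> borel_measurable lebesgue"
      by measurable
  qed
  also have "\<dots> = fourier_integral g \<xi>"
    unfolding fourier_integral_def by (rule integral_completion) measurable
  finally show "fourier_L1 f \<xi> = complex_of_real ((2 * pi) powr (- real CARD('n) / 2)) * fourier_integral g \<xi>"
    by (simp add: fourier_L1_def)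
qed

text \<open>
  The factor lost in \<open>bessel_fourier_integral\<close> is compensated by the unitary normalisation.
\<close>

lemma plancherel_constant:
  "ennreal ((cmod (complex_of_real ((2 * pi) powr (- real n / 2))))\<^sup>2) * ennreal ((2 * pi) ^ n) = 1"
proof -
  have "((2 * pi) powr (- real n / 2))\<^sup>2 * (2 * pi) ^ n = 1"
  proof -
    have "(2 * pi) ^ n = (2 * pi) powr real n" by (rule powr_realpow[symmetric]) simp
    thus ?thesis by (simp only: power2_eq_square powr_add[symmetric]) simp
  qed
  moreover have "cmod (complex_of_real ((2 * pi) powr (- real n / 2))) = (2 * pi) powr (- real n / 2)"
    by (simp only: norm_of_real) simp
  moreover have "ennreal (((2 * pi) powr (- real n / 2))\<^sup>2) * ennreal ((2 * pi) ^ n)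
      = ennreal (((2 * pi) powr (- real n / 2))\<^sup>2 * (2 * pi) ^ n)"
    by (rule ennreal_mult[symmetric]) simp_all
  ultimately show ?thesis by (simp only: ennreal_1)
qed

lemma fourier_L1_measurable [measurable]:
  fixes f :: "real ^ 'n \<Rightarrow> complex"
  assumes "f \<in> borel_measurable lebesgue"
  shows "fourier_L1 f \<in> borel_measurable lebesgue"
proof -
  from borel_representative[OF assms] obtain g
    where [measurable]: "g \<in> borel_measurable borel" and ae: "AE x in lborel. f x = g x" .
  note [measurable] = fourier_integral_measurable[of g]
  show ?thesis
    unfolding fourier_L1_eq_fourier_integral[OF assms \<open>g \<in> borel_measurable borel\<close> ae]
    by (intro measurable_completion) measurable
qed

lemma integrable_borel_representative:
  fixes f :: "real ^ 'n \<Rightarrow> complex"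
  assumes "integrable lebesgue f" "g \<in> borel_measurable borel" "AE x in lborel. f x = g x"
  shows "integrable lborel g"
proof -
  have "integrable lebesgue g"
    using assms(1)
  proof (rule integrable_cong_AE_imp)
    show "g \<in> borel_measurable lebesgue" using assms(2) by (intro measurable_completion) simp
    show "AE x in lebesgue. f x = g x" by (rule AE_completion) (rule assms)
  qed
  thus ?thesis using assms(2) by (subst (asm) integrable_completion) simp_all
qed

lemma fourier_L1_bessel:
  fixes f :: "real ^ 'n \<Rightarrow> complex"
  assumes "integrable lebesgue f"
  shows "sqnorm lebesgue (fourier_L1 f) \<le> sqnorm lebesgue f"
proof -
  from borel_representative[OF borel_measurable_integrable[OF assms]] obtain g
    where g: "g \<in> borel_measurable borel" and ae: "AE x in lborel. f x = g x" .
  have "sqnorm lebesgue (fourier_L1 f)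
    = ennreal ((cmod (complex_of_real ((2 * pi) powr (- real CARD('n) / 2))))\<^sup>2) * sqnorm lborel (fourier_integral g)"
    unfolding fourier_L1_eq_fourier_integral[OF borel_measurable_integrable[OF assms] g ae] sqnorm_lebesgue
    by (rule sqnorm_cmult) (simp add: fourier_integral_measurable g)
  also have "sqnorm lborel (fourier_integral g) \<le> ennreal ((2 * pi) ^ CARD('n)) * sqnorm lborel g"
    using bessel_fourier_integral[OF integrable_borel_representative[OF assms g ae]] by simp
  also have "sqnorm lborel g = sqnorm lebesgue f"
    unfolding sqnorm_lebesgue by (rule sqnorm_cong_AE) (use ae in eventually_elim, simp)
  finally show ?thesis
    by (simp only: mult.assoc[symmetric] plancherel_constant mult_1 mult_left_mono zero_le)
qed

lemma fourier_L1_plancherel_bounded_continuous: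
  fixes f :: "real ^ 'n \<Rightarrow> complex"
  assumes f: "integrable lebesgue f" and cont: "continuous_on UNIV f" and "bounded (range f)"
  shows "sqnorm lebesgue f \<le> sqnorm lebesgue (fourier_L1 f)"
proof -
  obtain B where B: "\<And>x. cmod (f x) \<le> B" using assms(3) by (auto simp: bounded_iff)
  have meas: "f \<in> borel_measurable borel" by (rule borel_measurable_continuous_onI[OF cont])
  have int: "integrable lborel f" using f meas by (subst (asm) integrable_completion) simp_all
  have "sqnorm lebesgue f = ennreal ((cmod (complex_of_real ((2 * pi) powr (- real CARD('n) / 2))))\<^sup>2) *
     (ennreal ((2 * pi) ^ CARD('n)) * sqnorm lborel f)"
    by (simp only: mult.assoc[symmetric] plancherel_constant mult_1 sqnorm_lebesgue)
  also have "ennreal ((2 * pi) ^ CARD('n)) * sqnorm lborel f \<le> sqnorm lborel (fourier_integral f)"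
    using plancherel_bounded_continuous[OF int cont B] by simp
  also have "ennreal ((cmod (complex_of_real ((2 * pi) powr (- real CARD('n) / 2))))\<^sup>2) * sqnorm lborel (fourier_integral f)
     = sqnorm lebesgue (fourier_L1 f)"
    unfolding fourier_L1_eq_fourier_integral[OF borel_measurable_integrable[OF f] meas AE_I2[OF refl]] sqnorm_lebesgue
    by (rule sqnorm_cmult[symmetric]) (simp add: fourier_integral_measurable meas)
  finally show ?thesis by (simp add: mult_left_mono)
qed

lemma fourier_L1_character_integrable:
  fixes f :: "real ^ 'n \<Rightarrow> complex"
  assumes "integrable lebesgue f"
  shows "integrable lebesgue (\<lambda>x. f x * cis (- (x \<bullet> \<xi>)))"
proof (rule Bochner_Integration.integrable_bound[OF assms])
  have [measurable]: "(\<lambda>x. cis (- (x \<bullet> \<xi>))) \<in> borel_measurable lebesgue"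
    by (intro measurable_completion) measurable
  note [measurable] = borel_measurable_integrable[OF assms]
  show "(\<lambda>x. f x * cis (- (x \<bullet> \<xi>))) \<in> borel_measurable lebesgue" by measurable
qed (simp add: norm_mult)

lemma fourier_L1_add:
  assumes "integrable lebesgue f" "integrable lebesgue g"
  shows "fourier_L1 (\<lambda>x. f x + g x) = (\<lambda>\<xi>. fourier_L1 f \<xi> + fourier_L1 g \<xi>)"
  using assms[THEN fourier_L1_character_integrable]
  by (simp add: fun_eq_iff fourier_L1_def distrib_right distrib_left)

lemma fourier_L1_diff:
  assumes "integrable lebesgue f" "integrable lebesgue g"
  shows "fourier_L1 (\<lambda>x. f x - g x) = (\<lambda>\<xi>. fourier_L1 f \<xi> - fourier_L1 g \<xi>)"
  using assms[THEN fourier_L1_character_integrable]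
  by (simp add: fun_eq_iff fourier_L1_def left_diff_distrib right_diff_distrib)

lemma fourier_L1_modulate_translate:
  fixes f :: "real ^ 'n \<Rightarrow> complex"
  assumes f: "integrable lebesgue f"
  shows "fourier_L1 (\<lambda>x. c * cis (a \<bullet> x) * f (x - b)) \<xi> = c * cis (- (b \<bullet> (\<xi> - a))) * fourier_L1 f (\<xi> - a)"
proof -
  define h where "h x = c * cis (a \<bullet> (x + b)) * f x * cis (- ((x + b) \<bullet> \<xi>))" for x
  have [measurable]: "(\<lambda>x. cis (- ((x + b) \<bullet> \<xi>))) \<in> borel_measurable lebesgue"
    "(\<lambda>x. cis (a \<bullet> (x + b))) \<in> borel_measurable lebesgue"
    by (intro measurable_completion, measurable)+
  note [measurable] = borel_measurable_integrable[OF f]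
  have meas: "h \<in> borel_measurable lebesgue" unfolding h_def by measurable
  have "(LINT x|lebesgue. (c * cis (a \<bullet> x) * f (x - b)) * cis (- (x \<bullet> \<xi>))) = (LINT x|lebesgue. h (- b + 1 *\<^sub>R x))"
    by (simp add: h_def)
  also have "\<dots> = (LINT x|lebesgue. h x)"
    by (rule integral_lebesgue_affine) (simp_all add: meas)
  also have "\<dots> = (LINT x|lebesgue. c * cis (- (b \<bullet> (\<xi> - a))) * (f x * cis (- (x \<bullet> (\<xi> - a)))))"
  proof (rule Bochner_Integration.integral_cong[OF refl])
    fix x
    have "cis (a \<bullet> (x + b)) * cis (- ((x + b) \<bullet> \<xi>)) = cis (- (b \<bullet> (\<xi> - a))) * cis (- (x \<bullet> (\<xi> - a)))"
      unfolding cis_mult by (simp add: inner_simps inner_commute[of a] algebra_simps)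
    thus "h x = c * cis (- (b \<bullet> (\<xi> - a))) * (f x * cis (- (x \<bullet> (\<xi> - a))))"
      by (simp add: h_def mult_ac)
  qed
  also have "\<dots> = c * cis (- (b \<bullet> (\<xi> - a))) * (LINT x|lebesgue. f x * cis (- (x \<bullet> (\<xi> - a))))"
    by (rule integral_mult_right_zero)
  finally show ?thesis by (simp add: fourier_L1_def)
qed

text \<open>
  The graph of the Fourier--Plancherel transform, described by approximating sequences. In contrast to
  the truncations to centred balls that define \<^const>\<open>fourier_L2\<close>, such sequences may be added,
  translated and modulated.
\<close>

definition plancherel_pair :: "(real ^ 'n \<Rightarrow> complex) \<Rightarrow> (real ^ 'n \<Rightarrow> complex) \<Rightarrow> bool" where
  "plancherel_pair f g \<longleftrightarrow> square_integrable f \<and> square_integrable g \<and>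
     (\<exists>h. (\<forall>n. integrable lebesgue (h n) \<and> square_integrable (h n)) \<and>
        (\<lambda>n. sqnorm lebesgue (\<lambda>x. h n x - f x)) \<longlonglongrightarrow> 0 \<and>
        (\<lambda>n. sqnorm lebesgue (\<lambda>x. fourier_L1 (h n) x - g x)) \<longlonglongrightarrow> 0)"

lemma plancherel_pairE:
  assumes "plancherel_pair f g"
  obtains h where "square_integrable f" "square_integrable g"
    "\<And>n. integrable lebesgue (h n)" "\<And>n. square_integrable (h n)"
    "(\<lambda>n. sqnorm lebesgue (\<lambda>x. h n x - f x)) \<longlonglongrightarrow> 0"
    "(\<lambda>n. sqnorm lebesgue (\<lambda>x. fourier_L1 (h n) x - g x)) \<longlonglongrightarrow> 0"
  using assms unfolding plancherel_pair_def by (elim conjE exE, intro that) auto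

lemma tendsto_0_le_twice_sum:
  assumes "(a \<longlongrightarrow> (0::ennreal)) F" "(b \<longlongrightarrow> 0) F"
    and "eventually (\<lambda>n. c n \<le> 2 * a n + 2 * b n) F"
  shows "(c \<longlongrightarrow> 0) F"
proof (rule tendsto_sandwich[OF _ assms(3) tendsto_const])
  have "((\<lambda>n. 2 * a n + 2 * b n) \<longlongrightarrow> 2 * 0 + 2 * 0) F"
    by (intro tendsto_add ennreal_tendsto_cmult assms) auto
  thus "((\<lambda>n. 2 * a n + 2 * b n) \<longlongrightarrow> 0) F" by simp
qed simp

text \<open>
  By the Bessel inequality the transforms of a convergent sequence form a Cauchy sequence in mean
  square.
\<close>

lemma fourier_L1_limit_exists:
  fixes f :: "real ^ 'n \<Rightarrow> complex"
  assumes f: "square_integrable f" and h1: "\<And>n. integrable lebesgue (h n)" and h2: "\<And>n. square_integrable (h n)"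
    and lim: "(\<lambda>n. sqnorm lebesgue (\<lambda>x. h n x - f x)) \<longlonglongrightarrow> 0"
  obtains g where "square_integrable g"
    "(\<lambda>n. sqnorm lebesgue (\<lambda>x. fourier_L1 (h n) x - g x)) \<longlonglongrightarrow> 0"
proof -
  note [measurable] = square_integrableD(1)[OF f] square_integrableD(1)[OF h2]
  have Cauchy: "\<exists>N. \<forall>m\<ge>N. \<forall>n\<ge>N. sqnorm lebesgue (\<lambda>x. fourier_L1 (h m) x - fourier_L1 (h n) x) \<le> ennreal e"
    if "e > 0" for e
  proof -
    have "eventually (\<lambda>n. sqnorm lebesgue (\<lambda>x. h n x - f x) < ennreal (e / 4)) sequentially"
      using lim that by (intro order_tendstoD(2)) auto
    then obtain N where N: "\<And>n. n \<ge> N \<Longrightarrow> sqnorm lebesgue (\<lambda>x. h n x - f x) < ennreal (e / 4)"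
      by (auto simp: eventually_sequentially)
    have "sqnorm lebesgue (\<lambda>x. fourier_L1 (h m) x - fourier_L1 (h n) x) \<le> ennreal e" if "m \<ge> N" "n \<ge> N" for m n
    proof -
      have "sqnorm lebesgue (\<lambda>x. fourier_L1 (h m) x - fourier_L1 (h n) x) \<le> sqnorm lebesgue (\<lambda>x. h m x - h n x)"
        using fourier_L1_bessel[OF Bochner_Integration.integrable_diff[OF h1 h1], of m n]
        unfolding fourier_L1_diff[OF h1 h1] .
      also have "\<dots> \<le> 2 * sqnorm lebesgue (\<lambda>x. h m x - f x) + 2 * sqnorm lebesgue (\<lambda>x. f x - h n x)"
        by (rule sqnorm_diff_triangle) measurable
      also have "\<dots> \<le> ennreal 2 * ennreal (e / 4) + ennreal 2 * ennreal (e / 4)"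
        unfolding sqnorm_minus_commute[of _ f] ennreal_numeral
        using N[OF that(1)] N[OF that(2)] by (intro add_mono mult_left_mono) (auto intro: less_imp_le)
      also have "\<dots> = ennreal e"
        using \<open>e > 0\<close> by (simp only: ennreal_mult[symmetric] ennreal_plus[symmetric]) simp
      finally show ?thesis .
    qed
    thus ?thesis by blast
  qed
  obtain g where g: "g \<in> borel_measurable lebesgue"
    and lim_g: "(\<lambda>n. sqnorm lebesgue (\<lambda>x. fourier_L1 (h n) x - g x)) \<longlonglongrightarrow> 0"
    by (rule sqnorm_complete[of "\<lambda>n. fourier_L1 (h n)" lebesgue, OF _ Cauchy]) (simp_all add: fourier_L1_measurable)
  have "eventually (\<lambda>n. sqnorm lebesgue (\<lambda>x. fourier_L1 (h n) x - g x) < 1) sequentially"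
    by (rule order_tendstoD(2)[OF lim_g]) simp
  then obtain n where n: "sqnorm lebesgue (\<lambda>x. fourier_L1 (h n) x - g x) < 1"
    by (auto simp: eventually_sequentially)
  have "square_integrable (fourier_L1 (h n))"
    using fourier_L1_bessel[OF h1[of n]] square_integrableD(2)[OF h2[of n]]
    by (auto simp: square_integrable_iff)
  hence "square_integrable g"
    by (rule square_integrable_close[OF g]) (use n in \<open>auto intro: less_trans\<close>)
  thus ?thesis using lim_g by (rule that)
qed

text \<open>
  The limit over integer radii exists by completeness. The Bessel inequality extends the
  convergence to real radii, so that the choice in the definition of \<^const>\<open>fourier_L2\<close> has a
  witness.
\<close>

lemma fourier_L2_pair:
  fixes f :: "real ^ 'n \<Rightarrow> complex"
  assumes f: "square_integrable f"
  shows "plancherel_pair f (fourier_L2 f)"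
proof -
  define t where "t R x = indicator (cball 0 R) x *\<^sub>R f x" for R x
  have t_fun: "(\<lambda>x. indicator (cball 0 R) x *\<^sub>R f x) = t R" for R by (simp add: t_def fun_eq_iff)
  note t = square_integrable_truncation[OF f, folded t_def]
  note [measurable] = square_integrableD(1)[OF f] square_integrableD(1)[OF t(1)]
  obtain g where g: "square_integrable g"
    and lim: "(\<lambda>n. sqnorm lebesgue (\<lambda>x. fourier_L1 (t (real n)) x - g x)) \<longlonglongrightarrow> 0"
    by (rule fourier_L1_limit_exists[OF f t(2) t(1) t(3)])
  note [measurable] = square_integrableD(1)[OF g]
  let ?F = "\<lambda>n. fourier_L1 (t (real n))"
  \<comment> \<open>A real radius is compared with the largest integer radius below it.\<close>
  define N where "N R = nat \<lfloor>R\<rfloor>" for R :: real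
  have N: "filterlim N sequentially at_top"
    unfolding N_def by (rule filterlim_compose[OF filterlim_nat_sequentially filterlim_floor_sequentially])
  have lim': "((\<lambda>R. sqnorm lebesgue (\<lambda>x. fourier_L1 (t R) x - g x)) \<longlongrightarrow> 0) at_top"
  proof (rule tendsto_0_le_twice_sum)
    show "((\<lambda>R. sqnorm lebesgue (\<lambda>x. t (real (N R)) x - f x)) \<longlongrightarrow> 0) at_top"
      by (rule filterlim_compose[OF t(3) N])
    show "((\<lambda>R. sqnorm lebesgue (\<lambda>x. ?F (N R) x - g x)) \<longlongrightarrow> 0) at_top"
      by (rule filterlim_compose[OF lim N])
    show "\<forall>\<^sub>F R in at_top. sqnorm lebesgue (\<lambda>x. fourier_L1 (t R) x - g x)
       \<le> 2 * sqnorm lebesgue (\<lambda>x. t (real (N R)) x - f x) + 2 * sqnorm lebesgue (\<lambda>x. ?F (N R) x - g x)"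
      using eventually_ge_at_top[of 0]
    proof eventually_elim
      case (elim R)
      have "real (N R) \<le> R" using elim by (simp add: N_def)
      hence "cmod (t R x - t (real (N R)) x) \<le> cmod (t (real (N R)) x - f x)" for x
        by (auto simp: t_def indicator_def)
      hence "sqnorm lebesgue (\<lambda>x. t R x - t (real (N R)) x) \<le> sqnorm lebesgue (\<lambda>x. t (real (N R)) x - f x)"
        unfolding sqnorm_def by (intro nn_integral_mono ennreal_leI power_mono) auto
      moreover have "sqnorm lebesgue (\<lambda>x. fourier_L1 (t R) x - ?F (N R) x) \<le> sqnorm lebesgue (\<lambda>x. t R x - t (real (N R)) x)"
        using fourier_L1_bessel[OF Bochner_Integration.integrable_diff[OF t(2) t(2)], of R "real (N R)"]
        unfolding fourier_L1_diff[OF t(2) t(2)] .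
      moreover have "sqnorm lebesgue (\<lambda>x. fourier_L1 (t R) x - g x)
         \<le> 2 * sqnorm lebesgue (\<lambda>x. fourier_L1 (t R) x - ?F (N R) x) + 2 * sqnorm lebesgue (\<lambda>x. ?F (N R) x - g x)"
        by (rule sqnorm_diff_triangle) measurable
      ultimately show ?case by (meson add_mono mult_left_mono order_refl order_trans zero_le)
    qed
  qed
  have "square_integrable (fourier_L2 f) \<and>
     ((\<lambda>R. sqnorm lebesgue (\<lambda>x. fourier_L1 (t R) x - fourier_L2 f x)) \<longlongrightarrow> 0) at_top"
    unfolding fourier_L2_def sqnorm_def t_fun
    by (rule someI[of _ g]) (use g lim' in \<open>simp add: sqnorm_def\<close>)
  hence "square_integrable (fourier_L2 f)"
    "(\<lambda>n. sqnorm lebesgue (\<lambda>x. fourier_L1 (t (real n)) x - fourier_L2 f x)) \<longlonglongrightarrow> 0"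
    using filterlim_compose[OF _ filterlim_real_sequentially] by auto
  thus ?thesis unfolding plancherel_pair_def using f t
    by (intro conjI exI[of _ "\<lambda>n. t (real n)"] allI) simp_all
qed

text \<open>
  Two sequences with the same limit have transforms with the same limit, again by the Bessel
  inequality. Thus the approximating sequence may be exchanged for a more regular one.
\<close>

lemma plancherel_pair_limit:
  fixes f :: "real ^ 'n \<Rightarrow> complex"
  assumes fg: "plancherel_pair f g" and h1: "\<And>n. integrable lebesgue (h n)" and h2: "\<And>n. square_integrable (h n)"
    and lim: "(\<lambda>n. sqnorm lebesgue (\<lambda>x. h n x - f x)) \<longlonglongrightarrow> 0"
  shows "(\<lambda>n. sqnorm lebesgue (\<lambda>x. fourier_L1 (h n) x - g x)) \<longlonglongrightarrow> 0"
proof -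
  obtain k where f: "square_integrable f" and g: "square_integrable g"
    and k1: "\<And>n. integrable lebesgue (k n)" and k2: "\<And>n. square_integrable (k n)"
    and k: "(\<lambda>n. sqnorm lebesgue (\<lambda>x. k n x - f x)) \<longlonglongrightarrow> 0"
    and kg: "(\<lambda>n. sqnorm lebesgue (\<lambda>x. fourier_L1 (k n) x - g x)) \<longlonglongrightarrow> 0"
    by (rule plancherel_pairE[OF fg]) (rule that; simp)
  note [measurable] = square_integrableD(1)[OF f] square_integrableD(1)[OF g]
    square_integrableD(1)[OF h2] square_integrableD(1)[OF k2]
  have "(\<lambda>n. sqnorm lebesgue (\<lambda>x. h n x - k n x)) \<longlonglongrightarrow> 0"
  proof (rule tendsto_0_le_twice_sum[OF lim k])
    show "\<forall>\<^sub>F n in sequentially. sqnorm lebesgue (\<lambda>x. h n x - k n x)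
       \<le> 2 * sqnorm lebesgue (\<lambda>x. h n x - f x) + 2 * sqnorm lebesgue (\<lambda>x. k n x - f x)"
      unfolding sqnorm_minus_commute[of _ "k _" f]
      by (intro always_eventually allI sqnorm_diff_triangle) measurable
  qed
  thus ?thesis
  proof (rule tendsto_0_le_twice_sum[OF _ kg], intro always_eventually allI)
    fix n
    have "sqnorm lebesgue (\<lambda>x. fourier_L1 (h n) x - g x)
       \<le> 2 * sqnorm lebesgue (\<lambda>x. fourier_L1 (h n) x - fourier_L1 (k n) x) + 2 * sqnorm lebesgue (\<lambda>x. fourier_L1 (k n) x - g x)"
      by (rule sqnorm_diff_triangle) measurable
    also have "sqnorm lebesgue (\<lambda>x. fourier_L1 (h n) x - fourier_L1 (k n) x) \<le> sqnorm lebesgue (\<lambda>x. h n x - k n x)"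
      using fourier_L1_bessel[OF Bochner_Integration.integrable_diff[OF h1 k1], of n n]
      unfolding fourier_L1_diff[OF h1 k1] .
    finally show "sqnorm lebesgue (\<lambda>x. fourier_L1 (h n) x - g x)
       \<le> 2 * sqnorm lebesgue (\<lambda>x. h n x - k n x) + 2 * sqnorm lebesgue (\<lambda>x. fourier_L1 (k n) x - g x)"
      by (simp add: mult_left_mono add_mono)
  qed
qed

text \<open>
  Along bounded continuous approximations the transform preserves norms, and norms pass to the limit.
\<close>

lemma plancherel_pair_isometry:
  fixes f g :: "real ^ 'n \<Rightarrow> complex"
  assumes fg: "plancherel_pair f g"
  shows "sqnorm lebesgue g = sqnorm lebesgue f"
proof -
  have f: "square_integrable f" and g: "square_integrable g"
    using fg by (simp_all add: plancherel_pair_def)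
  obtain h where cont: "\<And>n. continuous_on UNIV (h n)" "\<And>n. bounded (range (h n))"
    and h: "\<And>n. integrable lebesgue (h n)" "\<And>n. square_integrable (h n)"
      "(\<lambda>n. sqnorm lebesgue (\<lambda>x. h n x - f x)) \<longlonglongrightarrow> 0"
    by (rule bounded_continuous_dense[OF f]) (rule that; simp)
  note lim = plancherel_pair_limit[OF fg h]
  note [measurable] = square_integrableD(1)[OF f] square_integrableD(1)[OF g] square_integrableD(1)[OF h(2)]
  show ?thesis
  proof (rule antisym)
    show "sqnorm lebesgue g \<le> sqnorm lebesgue f"
      by (rule sqnorm_tendsto_le[OF _ _ _ _ lim h(3)]) (measurable, rule fourier_L1_bessel[OF h(1)])
    show "sqnorm lebesgue f \<le> sqnorm lebesgue g"
      by (rule sqnorm_tendsto_le[OF _ _ _ _ h(3) lim])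
         (measurable, rule fourier_L1_plancherel_bounded_continuous[OF h(1) cont])
  qed
qed

lemma plancherel_pair_add:
  assumes "plancherel_pair f g" "plancherel_pair f' g'"
  shows "plancherel_pair (\<lambda>x. f x + f' x) (\<lambda>x. g x + g' x)"
proof -
  obtain h where h: "square_integrable f" "square_integrable g" "\<And>n. integrable lebesgue (h n)" "\<And>n. square_integrable (h n)"
    "(\<lambda>n. sqnorm lebesgue (\<lambda>x. h n x - f x)) \<longlonglongrightarrow> 0"
    "(\<lambda>n. sqnorm lebesgue (\<lambda>x. fourier_L1 (h n) x - g x)) \<longlonglongrightarrow> 0"
    by (rule plancherel_pairE[OF assms(1)]) (rule that; simp)
  obtain k where k: "square_integrable f'" "square_integrable g'" "\<And>n. integrable lebesgue (k n)" "\<And>n. square_integrable (k n)"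
    "(\<lambda>n. sqnorm lebesgue (\<lambda>x. k n x - f' x)) \<longlonglongrightarrow> 0"
    "(\<lambda>n. sqnorm lebesgue (\<lambda>x. fourier_L1 (k n) x - g' x)) \<longlonglongrightarrow> 0"
    by (rule plancherel_pairE[OF assms(2)]) (rule that; simp)
  note [measurable] = h(1,2,4)[THEN square_integrableD(1)] k(1,2,4)[THEN square_integrableD(1)]
  have "(\<lambda>n. sqnorm lebesgue (\<lambda>x. (h n x + k n x) - (f x + f' x))) \<longlonglongrightarrow> 0"
    unfolding add_diff_add
    by (rule tendsto_0_le_twice_sum[OF h(5) k(5)], intro always_eventually allI sqnorm_add_le) measurable
  moreover have "(\<lambda>n. sqnorm lebesgue (\<lambda>x. fourier_L1 (\<lambda>x. h n x + k n x) x - (g x + g' x))) \<longlonglongrightarrow> 0"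
    unfolding fourier_L1_add[OF h(3) k(3)] add_diff_add
    by (rule tendsto_0_le_twice_sum[OF h(6) k(6)], intro always_eventually allI sqnorm_add_le) measurable
  moreover have "integrable lebesgue (\<lambda>x. h n x + k n x)" "square_integrable (\<lambda>x. h n x + k n x)" for n
    by (intro Bochner_Integration.integrable_add h k square_integrable_add)+
  ultimately show ?thesis
    unfolding plancherel_pair_def using h(1,2) k(1,2)
    by (intro conjI square_integrable_add exI[of _ "\<lambda>n x. h n x + k n x"]) auto
qed

lemma square_integrable_modulate_translate:
  fixes f :: "real ^ 'n \<Rightarrow> complex"
  assumes "square_integrable f"
  shows "square_integrable (\<lambda>x. c * cis (a \<bullet> (x - d)) * f (x - b))"
proof -
  have "square_integrable (\<lambda>x. f (x - b))"
    using square_integrable_affine[OF assms, of 1 "- b"] by simp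
  moreover have "(\<lambda>x. c * cis (a \<bullet> (x - d))) \<in> borel_measurable lebesgue"
    by (intro measurable_completion) measurable
  ultimately show ?thesis
    by (rule square_integrable_bounded_mult[where B = "cmod c"]) (simp add: norm_mult)
qed

lemma plancherel_pair_modulate_translate:
  fixes f g :: "real ^ 'n \<Rightarrow> complex"
  assumes "plancherel_pair f g"
  shows "plancherel_pair (\<lambda>x. c * cis (a \<bullet> x) * f (x - b))
     (\<lambda>\<xi>. c * cis (- (b \<bullet> (\<xi> - a))) * g (\<xi> - a))"
proof -
  obtain h where h: "square_integrable f" "square_integrable g" "\<And>n. integrable lebesgue (h n)" "\<And>n. square_integrable (h n)"
    "(\<lambda>n. sqnorm lebesgue (\<lambda>x. h n x - f x)) \<longlonglongrightarrow> 0"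
    "(\<lambda>n. sqnorm lebesgue (\<lambda>x. fourier_L1 (h n) x - g x)) \<longlonglongrightarrow> 0"
    by (rule plancherel_pairE[OF assms(1)]) (rule that; simp)
  have sq: "sqnorm lebesgue (\<lambda>x. c * cis (\<phi> x) * u (x - b)) = ennreal ((cmod c)\<^sup>2) * sqnorm lebesgue u"
    if u: "u \<in> borel_measurable lebesgue" for u :: "real ^ 'n \<Rightarrow> complex" and \<phi> b
  proof -
    have "sqnorm lebesgue (\<lambda>x. c * cis (\<phi> x) * u (x - b)) = sqnorm lebesgue (\<lambda>x. c * u (- b + 1 *\<^sub>R x))"
      by (simp add: sqnorm_def norm_mult)
    also have "\<dots> = ennreal ((cmod c)\<^sup>2) * sqnorm lebesgue (\<lambda>x. u (- b + 1 *\<^sub>R x))"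
      by (rule sqnorm_cmult) (intro borel_measurable_lebesgue_affine u disjI1 refl)
    also have "sqnorm lebesgue (\<lambda>x. u (- b + 1 *\<^sub>R x)) = sqnorm lebesgue u"
      by (rule sqnorm_lebesgue_affine) (simp_all add: u)
    finally show ?thesis .
  qed
  note [measurable] = h(1,2,4)[THEN square_integrableD(1)]
  have lim: "(\<lambda>n. ennreal ((cmod c)\<^sup>2) * s n) \<longlonglongrightarrow> 0" if "s \<longlonglongrightarrow> 0" for s
    using ennreal_tendsto_cmult[OF _ that, of "ennreal ((cmod c)\<^sup>2)"] by simp
  let ?h = "\<lambda>n x. c * cis (a \<bullet> x) * h n (x - b)"
  have "sqnorm lebesgue (\<lambda>x. ?h n x - c * cis (a \<bullet> x) * f (x - b)) = ennreal ((cmod c)\<^sup>2) * sqnorm lebesgue (\<lambda>x. h n x - f x)" for n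
    using sq[of "\<lambda>x. h n x - f x" "\<lambda>x. a \<bullet> x" b] by (simp add: right_diff_distrib)
  hence "(\<lambda>n. sqnorm lebesgue (\<lambda>x. ?h n x - c * cis (a \<bullet> x) * f (x - b))) \<longlonglongrightarrow> 0"
    using lim[OF h(5)] by simp
  moreover have "sqnorm lebesgue (\<lambda>\<xi>. fourier_L1 (?h n) \<xi> - c * cis (- (b \<bullet> (\<xi> - a))) * g (\<xi> - a))
      = ennreal ((cmod c)\<^sup>2) * sqnorm lebesgue (\<lambda>x. fourier_L1 (h n) x - g x)" for n
    unfolding fourier_L1_modulate_translate[OF h(3)]
    using sq[of "\<lambda>x. fourier_L1 (h n) x - g x" "\<lambda>\<xi>. - (b \<bullet> (\<xi> - a))" a] by (simp add: right_diff_distrib)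
  hence "(\<lambda>n. sqnorm lebesgue (\<lambda>\<xi>. fourier_L1 (?h n) \<xi> - c * cis (- (b \<bullet> (\<xi> - a))) * g (\<xi> - a))) \<longlonglongrightarrow> 0"
    using lim[OF h(6)] by simp
  moreover have "integrable lebesgue (?h n)" for n
  proof (rule Bochner_Integration.integrable_bound)
    show "integrable lebesgue (\<lambda>x. c * h n (- b + 1 *\<^sub>R x))"
      by (intro integrable_mult_right integrable_lebesgue_affine h disjI1 refl)
    show "?h n \<in> borel_measurable lebesgue"
      using square_integrable_modulate_translate[OF h(4)[of n], of c a 0 b] by (simp add: square_integrable_iff)
  qed (simp add: norm_mult)
  moreover have "square_integrable (?h n)" for n
    using square_integrable_modulate_translate[OF h(4)[of n], of c a 0 b] by simp
  moreover have "square_integrable (\<lambda>x. c * cis (a \<bullet> x) * f (x - b))"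
    using square_integrable_modulate_translate[OF h(1), of c a 0 b] by simp
  moreover have "square_integrable (\<lambda>\<xi>. c * cis (- (b \<bullet> (\<xi> - a))) * g (\<xi> - a))"
    using square_integrable_modulate_translate[OF h(2), of c "- b" a a] by simp
  ultimately show ?thesis
    unfolding plancherel_pair_def by (intro conjI exI[of _ ?h]) auto
qed

lemma plancherel_pair_sum:
  assumes "finite A" "\<And>k. k \<in> A \<Longrightarrow> plancherel_pair (f k) (g k)"
  shows "plancherel_pair (\<lambda>x. \<Sum>k\<in>A. f k x) (\<lambda>x. \<Sum>k\<in>A. g k x)"
  using assms
proof (induction A rule: finite_induct)
  case empty
  have "square_integrable (\<lambda>x. 0)" by (simp add: square_integrable_def)
  from plancherel_pair_modulate_translate[OF fourier_L2_pair[OF this], of 0 0 0]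
  show ?case by simp
next
  case (insert k A)
  thus ?case by (simp add: plancherel_pair_add)
qed

section \<open>An extrapolation polynomial\<close>

text \<open>
  The polynomial is the sum of the terms \<open>j \<ge> K\<close> in the binomial expansion of
  \<open>1 = (z + (1 - z)) ^ (2 K)\<close>. Each of these terms is divisible by \<open>z ^ K\<close>. The remaining terms, whose sum is
  \<open>1 - p\<close>, contain at least \<open>K\<close> factors \<open>1 - z\<close> and are at most \<open>4 ^ K * (1 / 8) ^ K\<close> in total. Expanding
  the powers of \<open>1 - z\<close> bounds the coefficients by \<open>(1 + 2) ^ (2 K)\<close>.

  An index \<open>(j, i)\<close> stands for the term of degree \<open>i\<close> in the expansion of \<open>(1 - z) ^ (2 K - j)\<close>.
  Collecting equal powers of \<open>z\<close> would bring nothing, since only the sum of absolute values matters.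
\<close>

lemma extrapolation_polynomial:
  fixes K :: nat
  assumes "K \<ge> 1"
  obtains A :: "(nat \<times> nat) set" and c :: "nat \<times> nat \<Rightarrow> real" and e :: "nat \<times> nat \<Rightarrow> nat"
  where "finite A" "\<And>k. k \<in> A \<Longrightarrow> K \<le> e k" "(\<Sum>k\<in>A. \<bar>c k\<bar>) \<le> 9 ^ K"
    "\<And>z :: complex. cmod z = 1 \<Longrightarrow> cmod (1 - z) \<le> 1 / 8 \<Longrightarrow>
       cmod (1 - (\<Sum>k\<in>A. complex_of_real (c k) * z ^ e k)) \<le> 1 / 2"
proof
  let ?A = "SIGMA j:{K..2*K}. {..2*K - j}"
  let ?c = "\<lambda>(j, i). real ((2*K) choose j) * (real ((2*K - j) choose i) * (-1) ^ i)"
  let ?e = "\<lambda>(j, i). j + i"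
  show "finite ?A" by simp
  show "K \<le> ?e k" if "k \<in> ?A" for k using that by auto
  \<comment> \<open>The absolute values of the coefficients of \<open>(1 - z) ^ m\<close> add up to \<open>2 ^ m\<close>.\<close>
  have "(\<Sum>k\<in>?A. \<bar>?c k\<bar>) = (\<Sum>j\<in>{K..2*K}. \<Sum>i\<le>2*K - j. real ((2*K) choose j) * real ((2*K - j) choose i))"
    by (subst sum.Sigma) (auto intro!: sum.cong simp: abs_mult)
  also have "\<dots> = (\<Sum>j\<in>{K..2*K}. real ((2*K) choose j) * 2 ^ (2*K - j))"
    by (intro sum.cong refl) (simp add: sum_distrib_left[symmetric] choose_row_sum flip: of_nat_sum)
  also have "\<dots> \<le> (\<Sum>j\<le>2*K. real ((2*K) choose j) * 2 ^ (2*K - j))"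
    by (rule sum_mono2) auto
  also have "\<dots> = (1 + 2) ^ (2*K)"
    by (subst binomial_ring) simp
  also have "\<dots> = 9 ^ K" by (simp add: power_mult)
  finally show "(\<Sum>k\<in>?A. \<bar>?c k\<bar>) \<le> 9 ^ K" .
  fix z :: complex
  assume z: "cmod z = 1" and near: "cmod (1 - z) \<le> 1 / 8"
  have "(\<Sum>k\<in>?A. complex_of_real (?c k) * z ^ ?e k)
      = (\<Sum>j\<in>{K..2*K}. \<Sum>i\<le>2*K - j. of_nat ((2*K) choose j) * z ^ j * (of_nat ((2*K - j) choose i) * (- z) ^ i))"
    by (subst sum.Sigma) (auto intro!: sum.cong simp: power_add power_minus[of z])
  also have "\<dots> = (\<Sum>j\<in>{K..2*K}. of_nat ((2*K) choose j) * z ^ j * (1 - z) ^ (2*K - j))"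
  proof (intro sum.cong refl)
    fix j
    have "(1 - z) ^ (2*K - j) = (- z + 1) ^ (2*K - j)" by simp
    also have "\<dots> = (\<Sum>i\<le>2*K - j. of_nat ((2*K - j) choose i) * (- z) ^ i)"
      by (subst binomial_ring) simp
    finally show "(\<Sum>i\<le>2*K - j. of_nat ((2*K) choose j) * z ^ j * (of_nat ((2*K - j) choose i) * (- z) ^ i))
       = of_nat ((2*K) choose j) * z ^ j * (1 - z) ^ (2*K - j)"
      by (simp add: sum_distrib_left)
  qed
  finally have p: "(\<Sum>k\<in>?A. complex_of_real (?c k) * z ^ ?e k)
      = (\<Sum>j\<in>{K..2*K}. of_nat ((2*K) choose j) * z ^ j * (1 - z) ^ (2*K - j))" .
  have "1 = (z + (1 - z)) ^ (2*K)" by simp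
  also have "\<dots> = (\<Sum>j\<le>2*K. of_nat ((2*K) choose j) * z ^ j * (1 - z) ^ (2*K - j))"
    by (rule binomial_ring)
  also have "{..2*K} = {..<K} \<union> {K..2*K}" by auto
  also have "(\<Sum>j\<in>\<dots>. of_nat ((2*K) choose j) * z ^ j * (1 - z) ^ (2*K - j))
    = (\<Sum>j<K. of_nat ((2*K) choose j) * z ^ j * (1 - z) ^ (2*K - j)) +
      (\<Sum>j\<in>{K..2*K}. of_nat ((2*K) choose j) * z ^ j * (1 - z) ^ (2*K - j))"
    by (rule sum.union_disjoint) auto
  finally have "1 - (\<Sum>k\<in>?A. complex_of_real (?c k) * z ^ ?e k)
     = (\<Sum>j<K. of_nat ((2*K) choose j) * z ^ j * (1 - z) ^ (2*K - j))"
    unfolding p by (simp add: algebra_simps)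
  also have "cmod \<dots> \<le> (\<Sum>j<K. cmod (of_nat ((2*K) choose j) * z ^ j * (1 - z) ^ (2*K - j)))"
    by (rule norm_sum)
  also have "\<dots> \<le> (\<Sum>j<K. real ((2*K) choose j) * (1 / 8) ^ K)"
  proof (rule sum_mono)
    fix j assume j: "j \<in> {..<K}"
    have "cmod (1 - z) ^ (2*K - j) \<le> (1 / 8) ^ (2*K - j)"
      using near by (intro power_mono) auto
    also have "\<dots> \<le> (1 / 8) ^ K"
      using j by (intro power_decreasing) auto
    finally show "cmod (of_nat ((2*K) choose j) * z ^ j * (1 - z) ^ (2*K - j)) \<le> real ((2*K) choose j) * (1 / 8) ^ K"
      using z by (simp add: norm_mult norm_power mult_left_mono)
  qed
  also have "\<dots> \<le> (\<Sum>j\<le>2*K. real ((2*K) choose j) * (1 / 8) ^ K)"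
    by (rule sum_mono2) auto
  also have "\<dots> = 4 ^ K * (1 / 8) ^ K"
    by (simp add: sum_distrib_right[symmetric] choose_row_sum power_mult flip: of_nat_sum)
  also have "\<dots> = (1 / 2) ^ K" by (simp add: power_mult_distrib[symmetric])
  also have "\<dots> \<le> (1 / 2) ^ 1" using assms by (intro power_decreasing) auto
  finally show "cmod (1 - (\<Sum>k\<in>?A. complex_of_real (?c k) * z ^ ?e k)) \<le> 1 / 2" by simp
qed

section \<open>Galilean invariance of the free flow\<close>

lemma norm_cis_minus_1_le: "cmod (1 - cis \<theta>) \<le> \<bar>\<theta>\<bar>"
proof -
  have "cmod (1 - cis \<theta>) = 2 * \<bar>sin (\<theta> / 2)\<bar>"
    using dist_exp_i_1[of \<theta>] by (simp add: norm_minus_commute cis_conv_exp)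
  also have "\<dots> \<le> 2 * \<bar>\<theta> / 2\<bar>"
    by (intro mult_left_mono abs_sin_x_le_abs_x) simp
  finally show ?thesis by simp
qed

lemma free_schrodinger_phase_square_integrable:
  fixes \<phi> :: "real ^ 'n \<Rightarrow> complex"
  assumes "square_integrable \<phi>"
  shows "square_integrable (\<lambda>\<xi>. cis (- (t * (norm \<xi>)\<^sup>2)) * \<phi> \<xi>)"
proof (rule square_integrable_bounded_mult[OF assms, where B = 1])
  show "(\<lambda>\<xi>::real^'n. cis (- (t * (norm \<xi>)\<^sup>2))) \<in> borel_measurable lebesgue"
    by (intro measurable_completion) measurable
qed simp

text \<open>
  The inverse transform is a reflected transform, hence the reflection on the right.
\<close>

lemma free_schrodinger_pair:
  assumes "square_integrable u"
  shows "plancherel_pair (\<lambda>\<xi>. cis (- (t * (norm \<xi>)\<^sup>2)) * fourier_L2 u \<xi>) (\<lambda>y. free_schrodinger u t (- y))"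
proof -
  have "square_integrable (fourier_L2 u)"
    using fourier_L2_pair[OF assms] by (simp add: plancherel_pair_def)
  from fourier_L2_pair[OF free_schrodinger_phase_square_integrable[OF this, of t]]
  show ?thesis by (simp add: free_schrodinger_def inverse_fourier_L2_def)
qed

lemma sqnorm_reflect:
  assumes "f \<in> borel_measurable lebesgue"
  shows "sqnorm lebesgue (\<lambda>x. f (- x)) = sqnorm lebesgue f"
  using sqnorm_lebesgue_affine[OF disjI2[OF refl] assms, of 0] by simp

lemma free_schrodinger_square_integrable:
  assumes "square_integrable u"
  shows "square_integrable (free_schrodinger u t)"
proof -
  have "square_integrable (\<lambda>y. free_schrodinger u t (- y))"
    using free_schrodinger_pair[OF assms] by (simp add: plancherel_pair_def)
  from square_integrable_affine[OF this disjI2[OF refl], of 0] show ?thesis by simp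
qed

lemma free_schrodinger_isometry:
  assumes u: "square_integrable u"
  shows "sqnorm lebesgue (free_schrodinger u t) = sqnorm lebesgue u"
proof -
  have "sqnorm lebesgue (free_schrodinger u t) = sqnorm lebesgue (\<lambda>y. free_schrodinger u t (- y))"
    by (rule sqnorm_reflect[symmetric]) (rule square_integrableD(1)[OF free_schrodinger_square_integrable[OF u]])
  also have "\<dots> = sqnorm lebesgue (\<lambda>\<xi>. cis (- (t * (norm \<xi>)\<^sup>2)) * fourier_L2 u \<xi>)"
    by (rule plancherel_pair_isometry[OF free_schrodinger_pair[OF u]])
  also have "\<dots> = sqnorm lebesgue (fourier_L2 u)"
    by (rule sqnorm_unimodular) simp
  also have "\<dots> = sqnorm lebesgue u"
    by (rule plancherel_pair_isometry[OF fourier_L2_pair[OF u]])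
  finally show ?thesis .
qed

text \<open>
  Galilean invariance. On the Fourier side the boost by \<open>e k *\<^sub>R \<beta>\<close> is the operator \<open>G k\<close> that shifts
  \<open>cis (- T |\<xi>|\<^sup>2) * \<phi> \<xi>\<close> by \<open>e k *\<^sub>R \<beta>\<close>. At time \<open>T\<close> this is multiplication by a character. At time \<open>S\<close> the
  quadratic phases combine to \<open>cis ((T - S) (|\<xi>|\<^sup>2 - |\<xi> - e k *\<^sub>R \<beta>|\<^sup>2))\<close>, whose exponent is affine in \<open>\<xi>\<close>,
  which produces a translation. Both functions in the conclusion arise from the same function of
  \<open>\<xi>\<close> by unimodular multipliers and an isometry, hence the equality of norms.
\<close>

lemma galilean_combination:
  fixes u :: "real ^ 'n \<Rightarrow> complex" and \<beta> x'' :: "real ^ 'n" and c e :: "'k \<Rightarrow> real" and S T :: real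
  assumes u: "square_integrable u" and A: "finite A"
  obtains D :: "'k \<Rightarrow> real ^ 'n \<Rightarrow> complex" where
    "\<And>k x. cmod (D k x) = 1" "\<And>k. D k \<in> borel_measurable lebesgue"
    "sqnorm lebesgue (\<lambda>x. free_schrodinger u S x -
        (\<Sum>k\<in>A. complex_of_real (c k) * D k x * free_schrodinger u S (x + (2 * (T - S) * e k) *\<^sub>R \<beta>)))
     = sqnorm lebesgue (\<lambda>x. (1 - (\<Sum>k\<in>A. complex_of_real (c k) * cis (e k * (\<beta> \<bullet> (x - x''))))) *
          free_schrodinger u T x)"
proof -
  define \<phi> where "\<phi> = fourier_L2 u"
  define m where "m t \<xi> = cis (- (t * (norm (\<xi> :: real ^ 'n))\<^sup>2))" for t \<xi>
  define v where "v t = free_schrodinger u t" for t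
  note pair = free_schrodinger_pair[OF u, folded \<phi>_def m_def v_def]
  \<comment> \<open>The constant factor centres the character at \<open>x''\<close>.\<close>
  define G where "G k \<xi> = cis (- (e k * (\<beta> \<bullet> x''))) * cnj (m T \<xi>) * (m T (\<xi> - e k *\<^sub>R \<beta>) * \<phi> (\<xi> - e k *\<^sub>R \<beta>))" for k \<xi>
  define \<psi> where "\<psi> \<xi> = \<phi> \<xi> - (\<Sum>k\<in>A. complex_of_real (c k) * G k \<xi>)" for \<xi>
  have m_unit: "cmod (m t \<xi>) = 1" for t \<xi> by (simp add: m_def)
  have mm: "m t \<xi> * cnj (m t \<xi>) = 1" for t \<xi>
    by (simp add: m_def cis_cnj cis_mult)
  \<comment> \<open>The part of the phase at time \<open>S\<close> that does not depend on \<open>\<xi>\<close>.\<close>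
  define \<theta> where "\<theta> k = - (e k * (\<beta> \<bullet> x'')) - (T - S) * (e k)\<^sup>2 * (\<beta> \<bullet> \<beta>)" for k
  let ?b = "\<lambda>k. e k *\<^sub>R \<beta>"
  let ?a = "\<lambda>k. (2 * (T - S) * e k) *\<^sub>R \<beta>"
  have GT: "m T \<xi> * G k \<xi> = cis (- (e k * (\<beta> \<bullet> x''))) * (m T (\<xi> - ?b k) * \<phi> (\<xi> - ?b k))" for k \<xi>
  proof -
    have "m T \<xi> * G k \<xi> = (m T \<xi> * cnj (m T \<xi>)) * (cis (- (e k * (\<beta> \<bullet> x''))) * (m T (\<xi> - ?b k) * \<phi> (\<xi> - ?b k)))"
      by (simp add: G_def mult_ac)
    thus ?thesis by (simp add: mm)
  qed
  have GS: "m S \<xi> * G k \<xi> = cis (\<theta> k) * cis (?a k \<bullet> \<xi>) * (m S (\<xi> - ?b k) * \<phi> (\<xi> - ?b k))" for k \<xi>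
  proof -
    have norm_diff: "(norm (\<xi> - ?b k))\<^sup>2 = (norm \<xi>)\<^sup>2 - 2 * e k * (\<beta> \<bullet> \<xi>) + (e k)\<^sup>2 * (\<beta> \<bullet> \<beta>)"
      unfolding power2_norm_eq_inner
      by (simp add: inner_diff_left inner_diff_right inner_commute algebra_simps power2_eq_square)
    have "m S \<xi> * (cis (- (e k * (\<beta> \<bullet> x''))) * cnj (m T \<xi>) * m T (\<xi> - ?b k)) = cis (\<theta> k) * cis (?a k \<bullet> \<xi>) * m S (\<xi> - ?b k)"
      unfolding m_def cis_cnj cis_mult norm_diff \<theta>_def by (rule arg_cong[where f = cis]) (simp add: algebra_simps)
    thus ?thesis by (simp add: G_def mult_ac)
  qed
  define D where "D k x = cis (\<theta> k) * cis (e k * (\<beta> \<bullet> (x + ?a k)))" for k x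
  define ET where "ET x = (1 - (\<Sum>k\<in>A. complex_of_real (c k) * cis (e k * (\<beta> \<bullet> (x - x''))))) * v T x" for x
  define ES where "ES x = v S x - (\<Sum>k\<in>A. complex_of_real (c k) * D k x * v S (x + ?a k))" for x
  have minus: "plancherel_pair (\<lambda>x. f x - (\<Sum>k\<in>A. f' k x)) (\<lambda>y. g y - (\<Sum>k\<in>A. g' k y))"
    if "plancherel_pair f g" "\<And>k. k \<in> A \<Longrightarrow> plancherel_pair (\<lambda>x. - f' k x) (\<lambda>y. - g' k y)"
    for f g :: "real ^ 'n \<Rightarrow> complex" and f' g' :: "'k \<Rightarrow> real ^ 'n \<Rightarrow> complex"
    using plancherel_pair_add[OF that(1) plancherel_pair_sum[OF A that(2)]] by (simp add: sum_negf)
  have pairT: "plancherel_pair (\<lambda>\<xi>. m T \<xi> * \<psi> \<xi>) (\<lambda>y. ET (- y))"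
  proof -
    have "plancherel_pair (\<lambda>\<xi>. m T \<xi> * \<phi> \<xi> - (\<Sum>k\<in>A. complex_of_real (c k) * (m T \<xi> * G k \<xi>)))
      (\<lambda>y. v T (- y) - (\<Sum>k\<in>A. complex_of_real (c k) * cis (e k * (\<beta> \<bullet> (- y - x''))) * v T (- y)))"
    proof (rule minus[OF pair])
      fix k
      have "cis (- (e k * (\<beta> \<bullet> x''))) * cis (- (?b k \<bullet> y)) = cis (e k * (\<beta> \<bullet> (- y - x'')))" for y
        unfolding cis_mult by (rule arg_cong[where f = cis]) (simp add: inner_simps algebra_simps)
      hence eq: "- complex_of_real (c k) * cis (- (e k * (\<beta> \<bullet> x''))) * cis (- (?b k \<bullet> (y - 0))) * v T (- (y - 0))
          = - (complex_of_real (c k) * cis (e k * (\<beta> \<bullet> (- y - x''))) * v T (- y))" for y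
        by simp
      show "plancherel_pair (\<lambda>\<xi>. - (complex_of_real (c k) * (m T \<xi> * G k \<xi>)))
        (\<lambda>y. - (complex_of_real (c k) * cis (e k * (\<beta> \<bullet> (- y - x''))) * v T (- y)))"
        using plancherel_pair_modulate_translate[OF pair[of T], of "- complex_of_real (c k) * cis (- (e k * (\<beta> \<bullet> x'')))" 0 "?b k"]
        unfolding eq GT by (simp add: mult_ac)
    qed
    thus ?thesis
      by (simp add: \<psi>_def ET_def right_diff_distrib left_diff_distrib sum_distrib_left sum_distrib_right mult_ac)
  qed
  have pairS: "plancherel_pair (\<lambda>\<xi>. m S \<xi> * \<psi> \<xi>) (\<lambda>y. ES (- y))"
  proof -
    have "plancherel_pair (\<lambda>\<xi>. m S \<xi> * \<phi> \<xi> - (\<Sum>k\<in>A. complex_of_real (c k) * (m S \<xi> * G k \<xi>)))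
      (\<lambda>y. v S (- y) - (\<Sum>k\<in>A. complex_of_real (c k) * D k (- y) * v S (- y + ?a k)))"
    proof (rule minus[OF pair])
      fix k
      have eq: "- complex_of_real (c k) * cis (\<theta> k) * cis (- (?b k \<bullet> (y - ?a k))) * v S (- (y - ?a k))
          = - (complex_of_real (c k) * D k (- y) * v S (- y + ?a k))" for y
        by (simp add: D_def inner_simps algebra_simps)
      show "plancherel_pair (\<lambda>\<xi>. - (complex_of_real (c k) * (m S \<xi> * G k \<xi>)))
        (\<lambda>y. - (complex_of_real (c k) * D k (- y) * v S (- y + ?a k)))"
        using plancherel_pair_modulate_translate[OF pair[of S], of "- complex_of_real (c k) * cis (\<theta> k)" "?a k" "?b k"]
        unfolding eq GS by (simp add: mult_ac)
    qed
    thus ?thesis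
      by (simp add: \<psi>_def ES_def right_diff_distrib sum_distrib_left mult_ac)
  qed
  have reflect: "sqnorm lebesgue E = sqnorm lebesgue \<psi>" if "plancherel_pair (\<lambda>\<xi>. m t \<xi> * \<psi> \<xi>) (\<lambda>y. E (- y))" for t E
  proof -
    have "square_integrable (\<lambda>y. E (- y))" using that by (simp add: plancherel_pair_def)
    hence "sqnorm lebesgue (\<lambda>x. E (- (- x))) = sqnorm lebesgue (\<lambda>y. E (- y))"
      by (intro sqnorm_reflect[of "\<lambda>y. E (- y)"] square_integrableD)
    also have "\<dots> = sqnorm lebesgue (\<lambda>\<xi>. m t \<xi> * \<psi> \<xi>)"
      by (rule plancherel_pair_isometry[OF that])
    also have "\<dots> = sqnorm lebesgue \<psi>"
      by (rule sqnorm_unimodular) (rule m_unit)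
    finally show ?thesis by simp
  qed
  have "cmod (D k x) = 1" for k x by (simp add: D_def norm_mult)
  moreover have "D k \<in> borel_measurable lebesgue" for k
    unfolding D_def by (intro measurable_completion) measurable
  moreover have "sqnorm lebesgue ES = sqnorm lebesgue ET"
    using reflect[OF pairS] reflect[OF pairT] by simp
  ultimately show ?thesis
    by (intro that[of D]) (simp_all add: ES_def[abs_def] ET_def[abs_def] v_def)
qed

section \<open>Observability at two times\<close>

text \<open>
  Cauchy--Schwarz with the weights \<open>|c k|\<close>.
\<close>

lemma norm_sum_mult_sq_le:
  fixes a :: "'k \<Rightarrow> complex"
  assumes "(\<Sum>k\<in>A. \<bar>c k\<bar>) \<le> L"
  shows "(cmod (\<Sum>k\<in>A. complex_of_real (c k) * a k))\<^sup>2 \<le> L * (\<Sum>k\<in>A. \<bar>c k\<bar> * (cmod (a k))\<^sup>2)"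
proof -
  have "cmod (\<Sum>k\<in>A. complex_of_real (c k) * a k) \<le> (\<Sum>k\<in>A. sqrt \<bar>c k\<bar> * (sqrt \<bar>c k\<bar> * cmod (a k)))"
    by (rule order_trans[OF norm_sum]) (simp add: norm_mult mult.assoc[symmetric])
  hence "(cmod (\<Sum>k\<in>A. complex_of_real (c k) * a k))\<^sup>2 \<le> (\<Sum>k\<in>A. sqrt \<bar>c k\<bar> * (sqrt \<bar>c k\<bar> * cmod (a k)))\<^sup>2"
    by (rule power_mono) simp
  also have "\<dots> \<le> (\<Sum>k\<in>A. (sqrt \<bar>c k\<bar>)\<^sup>2) * (\<Sum>k\<in>A. (sqrt \<bar>c k\<bar> * cmod (a k))\<^sup>2)"
    by (rule Cauchy_Schwarz_ineq_sum)
  also have "\<dots> = (\<Sum>k\<in>A. \<bar>c k\<bar>) * (\<Sum>k\<in>A. \<bar>c k\<bar> * (cmod (a k))\<^sup>2)"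
    by (simp add: power_mult_distrib)
  also have "\<dots> \<le> L * (\<Sum>k\<in>A. \<bar>c k\<bar> * (cmod (a k))\<^sup>2)"
    by (intro mult_right_mono assms sum_nonneg) simp
  finally show ?thesis .
qed

text \<open>
  The estimate before absorption: half of the mass appears on the right, with the masses outside the
  two balls. It is stated in the extended half-line, where no finiteness has to be tracked.
\<close>

lemma two_time_inequality:
  fixes u :: "real ^ 'n \<Rightarrow> complex" and x' x'' :: "real ^ 'n"
  assumes u: "square_integrable u" and r: "r\<^sub>1 > 0" "r\<^sub>2 > 0" and ST: "S < T"
    and K: "real K > 8 * r\<^sub>1 * r\<^sub>2 / (T - S)"
  shows "sqnorm lebesgue u \<le>
    ennreal (1 / 2) * sqnorm lebesgue u +
    ennreal (2 * (1 + 9 ^ K)\<^sup>2) * sqnorm lebesgue (\<lambda>x. indicator (- cball x'' r\<^sub>2) x *\<^sub>R free_schrodinger u T x) +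
    ennreal (2 * 9 ^ K * 9 ^ K + 1) * sqnorm lebesgue (\<lambda>x. indicator (- cball x' r\<^sub>1) x *\<^sub>R free_schrodinger u S x)"
proof -
  define \<tau> where "\<tau> = T - S"
  have \<tau>: "\<tau> > 0" using ST by (simp add: \<tau>_def)
  have "0 < 8 * r\<^sub>1 * r\<^sub>2 / (T - S)" using r ST by simp
  hence K1: "K \<ge> 1" using K by linarith
  obtain A :: "(nat \<times> nat) set" and c :: "nat \<times> nat \<Rightarrow> real" and e :: "nat \<times> nat \<Rightarrow> nat"
    where A: "finite A" and e: "\<And>k. k \<in> A \<Longrightarrow> K \<le> e k" and c: "(\<Sum>k\<in>A. \<bar>c k\<bar>) \<le> 9 ^ K"
      and p: "\<And>z :: complex. cmod z = 1 \<Longrightarrow> cmod (1 - z) \<le> 1 / 8 \<Longrightarrow>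
       cmod (1 - (\<Sum>k\<in>A. complex_of_real (c k) * z ^ e k)) \<le> 1 / 2"
    by (rule extrapolation_polynomial[OF K1]) (rule that; simp)
  define L :: real where "L = 9 ^ K"
  have L: "L \<ge> 0" by (simp add: L_def)
  note c = c[folded L_def]
  \<comment> \<open>Any unit vector serves.\<close>
  define a :: "real ^ 'n" where "a = axis undefined 1"
  have a: "norm a = 1" by (simp add: a_def norm_axis_1)
  \<comment> \<open>The largest length for which the character is within \<open>1 / 8\<close> of \<open>1\<close> on the ball of radius \<open>r\<^sub>2\<close>.\<close>
  define \<beta> where "\<beta> = (1 / (8 * r\<^sub>2)) *\<^sub>R a"
  define vS where "vS = free_schrodinger u S"
  define vT where "vT = free_schrodinger u T"
  have vS: "square_integrable vS" and vT: "square_integrable vT"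
    unfolding vS_def vT_def by (intro free_schrodinger_square_integrable u)+
  note [measurable] = vS[THEN square_integrableD(1)] vT[THEN square_integrableD(1)]
  have norm_vS: "sqnorm lebesgue vS = sqnorm lebesgue u" and norm_vT: "sqnorm lebesgue vT = sqnorm lebesgue u"
    unfolding vS_def vT_def by (intro free_schrodinger_isometry u)+
  define outS where "outS x = indicator (- cball x' r\<^sub>1) x *\<^sub>R vS x" for x
  define outT where "outT x = indicator (- cball x'' r\<^sub>2) x *\<^sub>R vT x" for x
  have [measurable]: "outS \<in> borel_measurable lebesgue" "outT \<in> borel_measurable lebesgue"
    unfolding outS_def outT_def by measurable
  let ?s = "\<lambda>k. (2 * (T - S) * real (e k)) *\<^sub>R \<beta>"
  have "\<exists>D :: nat \<times> nat \<Rightarrow> real ^ 'n \<Rightarrow> complex. (\<forall>k x. cmod (D k x) = 1) \<and> (\<forall>k. D k \<in> borel_measurable lebesgue) \<and>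
    sqnorm lebesgue (\<lambda>x. vS x - (\<Sum>k\<in>A. complex_of_real (c k) * D k x * vS (x + ?s k)))
     = sqnorm lebesgue (\<lambda>x. (1 - (\<Sum>k\<in>A. complex_of_real (c k) * cis (real (e k) * (\<beta> \<bullet> (x - x''))))) * vT x)"
    unfolding vS_def vT_def
    by (rule galilean_combination[OF u A, where S = S and c = c and e = "\<lambda>k. real (e k)" and T = T and \<beta> = \<beta> and x'' = x''])
       blast
  then obtain D :: "nat \<times> nat \<Rightarrow> real ^ 'n \<Rightarrow> complex" where D: "\<And>k x. cmod (D k x) = 1"
    and D_meas [measurable]: "\<And>k. D k \<in> borel_measurable lebesgue"
    and eq: "sqnorm lebesgue (\<lambda>x. vS x - (\<Sum>k\<in>A. complex_of_real (c k) * D k x * vS (x + ?s k)))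
     = sqnorm lebesgue (\<lambda>x. (1 - (\<Sum>k\<in>A. complex_of_real (c k) * cis (real (e k) * (\<beta> \<bullet> (x - x''))))) * vT x)"
    by blast
  define ES where "ES x = vS x - (\<Sum>k\<in>A. complex_of_real (c k) * D k x * vS (x + ?s k))" for x
  define q where "q x = 1 - (\<Sum>k\<in>A. complex_of_real (c k) * cis (real (e k) * (\<beta> \<bullet> (x - x''))))" for x
  have eq: "sqnorm lebesgue ES = sqnorm lebesgue (\<lambda>x. q x * vT x)"
    using eq by (simp add: ES_def[abs_def] q_def)
  have q_le: "cmod (q x) \<le> 1 + L" for x
  proof -
    have "cmod (q x) \<le> cmod 1 + cmod (\<Sum>k\<in>A. complex_of_real (c k) * cis (real (e k) * (\<beta> \<bullet> (x - x''))))"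
      unfolding q_def by (rule norm_triangle_ineq4)
    also have "cmod (\<Sum>k\<in>A. complex_of_real (c k) * cis (real (e k) * (\<beta> \<bullet> (x - x'')))) \<le> (\<Sum>k\<in>A. \<bar>c k\<bar>)"
      by (rule order_trans[OF norm_sum]) (simp add: norm_mult)
    finally show ?thesis using c by simp
  qed
  have q_small: "cmod (q x) \<le> 1 / 2" if "x \<in> cball x'' r\<^sub>2" for x
  proof -
    define z where "z = cis (\<beta> \<bullet> (x - x''))"
    have "\<bar>\<beta> \<bullet> (x - x'')\<bar> \<le> norm \<beta> * norm (x - x'')" by (rule Cauchy_Schwarz_ineq2)
    also have "\<dots> \<le> (1 / (8 * r\<^sub>2)) * r\<^sub>2"
      using that r a by (intro mult_mono) (auto simp: \<beta>_def dist_norm norm_minus_commute)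
    also have "\<dots> = 1 / 8" using r by simp
    finally have "cmod (1 - z) \<le> 1 / 8"
      unfolding z_def using norm_cis_minus_1_le order_trans by blast
    hence "cmod (1 - (\<Sum>k\<in>A. complex_of_real (c k) * z ^ e k)) \<le> 1 / 2"
      by (intro p) (simp_all add: z_def)
    thus ?thesis by (simp only: q_def z_def Complex.DeMoivre)
  qed
  \<comment> \<open>The factor \<open>1 / 4\<close> is small enough to survive the factor \<open>2\<close> in the decomposition of \<open>vS\<close>
    below with a constant less than \<open>1\<close>.\<close>
  have ET_le: "sqnorm lebesgue (\<lambda>x. q x * vT x)
      \<le> ennreal (1 / 4) * sqnorm lebesgue vT + ennreal ((1 + L)\<^sup>2) * sqnorm lebesgue outT"
  proof -
    have "(cmod (q x * vT x))\<^sup>2 \<le> 1 / 4 * (cmod (vT x))\<^sup>2 + (1 + L)\<^sup>2 * (cmod (outT x))\<^sup>2" for x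
    proof (cases "x \<in> cball x'' r\<^sub>2")
      case True
      have "(cmod (q x))\<^sup>2 \<le> (1 / 2)\<^sup>2" by (intro power_mono q_small True) simp
      hence "(cmod (q x))\<^sup>2 * (cmod (vT x))\<^sup>2 \<le> 1 / 4 * (cmod (vT x))\<^sup>2"
        by (intro mult_right_mono) (simp_all add: power_divide)
      moreover have "0 \<le> (1 + L)\<^sup>2 * (cmod (outT x))\<^sup>2" by simp
      ultimately show ?thesis by (simp only: norm_mult power_mult_distrib)
    next
      case False
      have "(cmod (q x))\<^sup>2 * (cmod (vT x))\<^sup>2 \<le> (1 + L)\<^sup>2 * (cmod (vT x))\<^sup>2"
        by (intro mult_right_mono power_mono q_le) simp_all
      moreover have "0 \<le> 1 / 4 * (cmod (vT x))\<^sup>2" by simp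
      moreover have "outT x = vT x" using False by (simp add: outT_def)
      ultimately show ?thesis by (simp only: norm_mult power_mult_distrib)
    qed
    hence "sqnorm lebesgue (\<lambda>x. q x * vT x) \<le> (\<integral>\<^sup>+x. ennreal (1 / 4) * ennreal ((cmod (vT x))\<^sup>2)
        + ennreal ((1 + L)\<^sup>2) * ennreal ((cmod (outT x))\<^sup>2) \<partial>lebesgue)"
      unfolding sqnorm_def
      by (intro nn_integral_mono)
         (simp add: ennreal_mult[symmetric] ennreal_plus[symmetric] del: ennreal_plus)
    also have "\<dots> = ennreal (1 / 4) * sqnorm lebesgue vT + ennreal ((1 + L)\<^sup>2) * sqnorm lebesgue outT"
      unfolding sqnorm_def by (subst nn_integral_add) (simp_all add: nn_integral_cmult)
    finally show ?thesis .
  qed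
  have [measurable]: "(\<lambda>x. vS (x + s)) \<in> borel_measurable lebesgue" "(\<lambda>x. outS (x + s)) \<in> borel_measurable lebesgue" for s
    using borel_measurable_lebesgue_affine[OF disjI1[OF refl], of vS s]
      borel_measurable_lebesgue_affine[OF disjI1[OF refl], of outS s] by (simp_all add: add.commute)
  have norm_outS_shift: "sqnorm lebesgue (\<lambda>x. outS (x + s)) = sqnorm lebesgue outS" for s
    using sqnorm_lebesgue_affine[OF disjI1[OF refl], of outS s] by (simp add: add.commute)
  have pointwise: "(cmod (vS x))\<^sup>2 \<le> 2 * (cmod (ES x))\<^sup>2 + 2 * L * (\<Sum>k\<in>A. \<bar>c k\<bar> * (cmod (outS (x + ?s k)))\<^sup>2)
      + (cmod (outS x))\<^sup>2" for x
  \<comment> \<open>The half-space contains the ball and touches it at its boundary. From each of its points, \<open>K\<close> or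
    more translation steps lead out of the ball, and its complement is disjoint from the ball.\<close>
  proof (cases "(x - x') \<bullet> a \<ge> - r\<^sub>1")
    case True
    have out: "vS (x + ?s k) = outS (x + ?s k)" if k: "k \<in> A" for k
    proof -
      have "2 * r\<^sub>1 < 2 * \<tau> * real K * (1 / (8 * r\<^sub>2))"
        using K r \<tau> unfolding \<tau>_def[symmetric] by (simp add: field_simps)
      also have "\<dots> \<le> 2 * \<tau> * real (e k) * (1 / (8 * r\<^sub>2))"
        using e[OF k] \<tau> r by (intro mult_right_mono mult_left_mono) simp_all
      finally have far: "2 * r\<^sub>1 < 2 * \<tau> * real (e k) * (1 / (8 * r\<^sub>2))" .
      have "r\<^sub>1 < (x - x') \<bullet> a + 2 * \<tau> * real (e k) * (1 / (8 * r\<^sub>2))" using True far by linarith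
      also have "\<dots> = (x + ?s k - x') \<bullet> a"
        using a by (simp add: \<beta>_def \<tau>_def inner_simps power2_norm_eq_inner[symmetric] dot_square_norm)
      also have "\<dots> \<le> norm (x + ?s k - x') * norm a" by (rule norm_cauchy_schwarz)
      also have "\<dots> = dist x' (x + ?s k)" using a by (simp add: dist_norm norm_minus_commute)
      finally show ?thesis by (simp add: outS_def)
    qed
    have "vS x = ES x + (\<Sum>k\<in>A. complex_of_real (c k) * (D k x * vS (x + ?s k)))"
      by (simp add: ES_def mult.assoc)
    also have "(\<Sum>k\<in>A. complex_of_real (c k) * (D k x * vS (x + ?s k)))
        = (\<Sum>k\<in>A. complex_of_real (c k) * (D k x * outS (x + ?s k)))"
      by (intro sum.cong refl) (simp only: out)
    finally have "(cmod (vS x))\<^sup>2 \<le> 2 * (cmod (ES x))\<^sup>2 +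
        2 * (cmod (\<Sum>k\<in>A. complex_of_real (c k) * (D k x * outS (x + ?s k))))\<^sup>2"
      using cmod_add_sq_le[of 1 "ES x" "\<Sum>k\<in>A. complex_of_real (c k) * (D k x * outS (x + ?s k))"] by simp
    also have "(cmod (\<Sum>k\<in>A. complex_of_real (c k) * (D k x * outS (x + ?s k))))\<^sup>2
        \<le> L * (\<Sum>k\<in>A. \<bar>c k\<bar> * (cmod (D k x * outS (x + ?s k)))\<^sup>2)"
      by (rule norm_sum_mult_sq_le[OF c])
    also have "\<dots> = L * (\<Sum>k\<in>A. \<bar>c k\<bar> * (cmod (outS (x + ?s k)))\<^sup>2)"
      by (simp add: norm_mult D)
    finally show ?thesis by (simp add: add_increasing2)
  next
    case False
    have "r\<^sub>1 < - ((x - x') \<bullet> a)" using False by simp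
    also have "\<dots> \<le> norm (x - x') * norm a" using Cauchy_Schwarz_ineq2[of "x - x'" a] by linarith
    finally have "outS x = vS x" using a by (simp add: outS_def dist_norm norm_minus_commute)
    moreover have "0 \<le> 2 * (cmod (ES x))\<^sup>2 + 2 * L * (\<Sum>k\<in>A. \<bar>c k\<bar> * (cmod (outS (x + ?s k)))\<^sup>2)"
      using L by (intro add_nonneg_nonneg mult_nonneg_nonneg sum_nonneg) simp_all
    ultimately show ?thesis by simp
  qed
  have [measurable]: "ES \<in> borel_measurable lebesgue" unfolding ES_def by measurable
  have sum_nonneg': "0 \<le> (\<Sum>k\<in>A. \<bar>c k\<bar> * (cmod (outS (x + ?s k)))\<^sup>2)" for x
    by (intro sum_nonneg) simp
  define R where "R x = (\<Sum>k\<in>A. ennreal \<bar>c k\<bar> * ennreal ((cmod (outS (x + ?s k)))\<^sup>2))" for x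
  have R: "ennreal (\<Sum>k\<in>A. \<bar>c k\<bar> * (cmod (outS (x + ?s k)))\<^sup>2) = R x" for x
    unfolding R_def by (subst sum_ennreal[symmetric]) (simp_all add: ennreal_mult)
  have [measurable]: "R \<in> borel_measurable lebesgue" unfolding R_def by measurable
  have int_R: "(\<integral>\<^sup>+x. R x \<partial>lebesgue) \<le> ennreal L * sqnorm lebesgue outS"
  proof -
    have "(\<integral>\<^sup>+x. R x \<partial>lebesgue) = (\<Sum>k\<in>A. ennreal \<bar>c k\<bar> * sqnorm lebesgue outS)"
      unfolding R_def sqnorm_def
      by (subst nn_integral_sum)
         (simp_all add: nn_integral_cmult norm_outS_shift[unfolded sqnorm_def])
    also have "\<dots> = ennreal (\<Sum>k\<in>A. \<bar>c k\<bar>) * sqnorm lebesgue outS"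
      by (simp add: sum_distrib_right[symmetric])
    also have "\<dots> \<le> ennreal L * sqnorm lebesgue outS"
      using c by (intro mult_right_mono ennreal_leI) simp_all
    finally show ?thesis .
  qed
  have "sqnorm lebesgue vS \<le> (\<integral>\<^sup>+x. (ennreal 2 * ennreal ((cmod (ES x))\<^sup>2) + ennreal (2 * L) * R x)
        + ennreal ((cmod (outS x))\<^sup>2) \<partial>lebesgue)"
    unfolding sqnorm_def
  proof (rule nn_integral_mono)
    fix x
    have "ennreal ((cmod (vS x))\<^sup>2) \<le> ennreal (2 * (cmod (ES x))\<^sup>2 + 2 * L * (\<Sum>k\<in>A. \<bar>c k\<bar> * (cmod (outS (x + ?s k)))\<^sup>2) + (cmod (outS x))\<^sup>2)"
      by (rule ennreal_leI[OF pointwise])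
    also have "\<dots> = ennreal (2 * (cmod (ES x))\<^sup>2) + ennreal (2 * L * (\<Sum>k\<in>A. \<bar>c k\<bar> * (cmod (outS (x + ?s k)))\<^sup>2)) + ennreal ((cmod (outS x))\<^sup>2)"
      using L sum_nonneg'[of x] by (simp add: ennreal_plus)
    also have "ennreal (2 * (cmod (ES x))\<^sup>2) = ennreal 2 * ennreal ((cmod (ES x))\<^sup>2)"
      by (rule ennreal_mult) simp_all
    also have "ennreal (2 * L * (\<Sum>k\<in>A. \<bar>c k\<bar> * (cmod (outS (x + ?s k)))\<^sup>2)) = ennreal (2 * L) * R x"
      unfolding R[symmetric] using L sum_nonneg'[of x] by (intro ennreal_mult) simp_all
    finally show "ennreal ((cmod (vS x))\<^sup>2) \<le> (ennreal 2 * ennreal ((cmod (ES x))\<^sup>2) + ennreal (2 * L) * R x) + ennreal ((cmod (outS x))\<^sup>2)" .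
  qed
  also have "\<dots> = ennreal 2 * sqnorm lebesgue ES + ennreal (2 * L) * (\<integral>\<^sup>+x. R x \<partial>lebesgue) + sqnorm lebesgue outS"
    unfolding sqnorm_def by (simp add: nn_integral_add nn_integral_cmult)
  also have "\<dots> \<le> ennreal 2 * (ennreal (1 / 4) * sqnorm lebesgue u + ennreal ((1 + L)\<^sup>2) * sqnorm lebesgue outT)
      + ennreal (2 * L) * (ennreal L * sqnorm lebesgue outS) + sqnorm lebesgue outS"
    unfolding eq using ET_le int_R by (intro add_mono mult_left_mono) (simp_all add: norm_vT)
  also have "\<dots> = ennreal (1 / 2) * sqnorm lebesgue u + ennreal (2 * (1 + L)\<^sup>2) * sqnorm lebesgue outT
      + ennreal (2 * L * L + 1) * sqnorm lebesgue outS"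
  proof -
    have "ennreal 2 * ennreal (1 / 4) = ennreal (1 / 2)"
      by (subst ennreal_mult[symmetric]) simp_all
    moreover have "ennreal 2 * ennreal ((1 + L)\<^sup>2) = ennreal (2 * (1 + L)\<^sup>2)"
      by (rule ennreal_mult[symmetric]) simp_all
    moreover have "ennreal (2 * L) * ennreal L = ennreal (2 * L * L)"
      using L by (intro ennreal_mult[symmetric]) simp_all
    moreover have "ennreal (2 * L * L + 1) = ennreal (2 * L * L) + 1"
      using L by (subst ennreal_plus) simp_all
    ultimately show ?thesis
      by (simp only: distrib_left distrib_right mult.assoc[symmetric] mult_1 add.assoc)
  qed
  finally show ?thesis
    unfolding norm_vS by (simp only: L_def vS_def vT_def outS_def[abs_def] outT_def[abs_def])
qed

theorem theorem1p1:
  "\<exists>C>0. \<forall>(x' :: real ^ 'n) (x'' :: real ^ 'n) (r\<^sub>1 :: real) (r\<^sub>2 :: real) (S :: real) (T :: real)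
      (u\<^sub>0 :: real ^ 'n \<Rightarrow> complex).
      r\<^sub>1 > 0 \<longrightarrow> r\<^sub>2 > 0 \<longrightarrow> S \<ge> 0 \<longrightarrow> T > S \<longrightarrow> square_integrable u\<^sub>0 \<longrightarrow>
      (LINT x|lebesgue. (cmod (u\<^sub>0 x))\<^sup>2)
        \<le> C * exp (C * r\<^sub>1 * r\<^sub>2 * (1 / (T - S))) *
          ((LINT x:- cball x' r\<^sub>1|lebesgue. (cmod (free_schrodinger u\<^sub>0 S x))\<^sup>2) +
           (LINT x:- cball x'' r\<^sub>2|lebesgue. (cmod (free_schrodinger u\<^sub>0 T x))\<^sup>2))"
proof (intro exI[of _ 1296] conjI allI impI)
  fix x' x'' :: "real ^ 'n" and r\<^sub>1 r\<^sub>2 S T :: real and u\<^sub>0 :: "real ^ 'n \<Rightarrow> complex"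
  assume r: "r\<^sub>1 > 0" "r\<^sub>2 > 0" and ST: "S < T" and u: "square_integrable u\<^sub>0"
  define \<rho> where "\<rho> = r\<^sub>1 * r\<^sub>2 / (T - S)"
  have \<rho>: "\<rho> > 0" using r ST by (simp add: \<rho>_def)
  \<comment> \<open>Strictly larger than \<open>8 * \<rho>\<close>, since the balls are closed.\<close>
  define K where "K = nat \<lfloor>8 * \<rho>\<rfloor> + 1"
  have K: "real K > 8 * \<rho>" "real K \<le> 8 * \<rho> + 1"
    using \<rho> unfolding K_def by linarith+
  define outS where "outS x = indicator (- cball x' r\<^sub>1) x *\<^sub>R free_schrodinger u\<^sub>0 S x" for x
  define outT where "outT x = indicator (- cball x'' r\<^sub>2) x *\<^sub>R free_schrodinger u\<^sub>0 T x" for x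
  have out_sq: "square_integrable (\<lambda>x. indicator (- cball y r) x *\<^sub>R free_schrodinger u\<^sub>0 t x)" for y r t
  proof -
    have "(\<lambda>x. complex_of_real (indicator (- cball y r) x)) \<in> borel_measurable lebesgue"
      by (simp add: borel_measurable_complex_iff borel_measurable_indicator)
    from square_integrable_bounded_mult[OF free_schrodinger_square_integrable[OF u] this, of 1 t]
    show ?thesis by (simp add: scaleR_conv_of_real indicator_def)
  qed
  define N where "N = (LINT x|lebesgue. (cmod (u\<^sub>0 x))\<^sup>2)"
  define a where "a = (LINT x:- cball x' r\<^sub>1|lebesgue. (cmod (free_schrodinger u\<^sub>0 S x))\<^sup>2)"
  define b where "b = (LINT x:- cball x'' r\<^sub>2|lebesgue. (cmod (free_schrodinger u\<^sub>0 T x))\<^sup>2)"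
  have out_norm: "sqnorm lebesgue (\<lambda>x. indicator (- cball y r) x *\<^sub>R free_schrodinger u\<^sub>0 t x)
      = ennreal (LINT x:- cball y r|lebesgue. (cmod (free_schrodinger u\<^sub>0 t x))\<^sup>2)" for y r t
    unfolding square_integrable_norm_eq[OF out_sq] set_lebesgue_integral_def
    by (intro arg_cong[where f = ennreal] Bochner_Integration.integral_cong) (simp_all add: indicator_def)
  have nonneg: "N \<ge> 0" "a \<ge> 0" "b \<ge> 0"
    unfolding N_def a_def b_def set_lebesgue_integral_def by (intro integral_nonneg_AE; simp)+
  define L :: real where "L = 9 ^ K"
  \<comment> \<open>Half of \<open>N\<close> is absorbed below, and \<open>1 + L \<le> 2 * L\<close> turns the constant into \<open>16 * 81 ^ K\<close>. With
    \<open>K \<le> 8 * \<rho> + 1\<close> this is at most \<open>1296 * exp (8 * ln 81 * \<rho>)\<close>, and \<open>8 * ln 81 \<le> 640\<close>.\<close>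
  have L: "L \<ge> 1" by (simp add: L_def)
  have "ennreal N \<le> ennreal (1 / 2) * ennreal N + ennreal (2 * (1 + L)\<^sup>2) * ennreal b + ennreal (2 * L * L + 1) * ennreal a"
    using two_time_inequality[OF u r ST, of K x'' x'] K(1)
    unfolding square_integrable_norm_eq[OF u] out_norm N_def a_def b_def L_def \<rho>_def by (simp add: mult.assoc)
  also have "\<dots> = ennreal (1 / 2 * N + 2 * (1 + L)\<^sup>2 * b + (2 * L * L + 1) * a)"
  proof -
    have sum3: "ennreal (x + y + z) = ennreal x + ennreal y + ennreal z" if "x \<ge> 0" "y \<ge> 0" "z \<ge> 0" for x y z
      using that by (simp add: ennreal_plus)
    have "ennreal (1 / 2 * N) = ennreal (1 / 2) * ennreal N"
      and "ennreal (2 * (1 + L)\<^sup>2 * b) = ennreal (2 * (1 + L)\<^sup>2) * ennreal b"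
      and "ennreal ((2 * L * L + 1) * a) = ennreal (2 * L * L + 1) * ennreal a"
      using nonneg L by (intro ennreal_mult; simp)+
    thus ?thesis using nonneg L by (subst sum3) (simp_all only:, simp_all)
  qed
  finally have "N \<le> 1 / 2 * N + 2 * (1 + L)\<^sup>2 * b + (2 * L * L + 1) * a"
    using nonneg L by (subst (asm) ennreal_le_iff) simp_all
  moreover have "(2 * L * L + 1) * a \<le> 2 * (1 + L)\<^sup>2 * a"
    using nonneg L by (intro mult_right_mono) (simp_all add: power2_eq_square algebra_simps)
  ultimately have "N \<le> 4 * (1 + L)\<^sup>2 * (a + b)"
    by (simp add: algebra_simps)
  also have "4 * (1 + L)\<^sup>2 \<le> 4 * (2 * L)\<^sup>2"
    using L by (intro mult_left_mono power_mono) simp_all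
  also have "4 * (2 * L)\<^sup>2 = 16 * 81 ^ K"
    by (simp add: L_def power_mult_distrib power2_eq_square flip: power_mult_distrib)
  also have "(81 :: real) ^ K = 81 powr real K" by (simp add: powr_realpow)
  also have "81 powr real K \<le> 81 powr (8 * \<rho> + 1)"
    using K(2) by (intro powr_mono) simp_all
  also have "81 powr (8 * \<rho> + 1) = 81 * exp (8 * ln 81 * \<rho>)"
    by (simp add: powr_def distrib_right exp_add mult_ac)
  also have "exp (8 * ln 81 * \<rho>) \<le> exp (1296 * \<rho>)"
  proof -
    have "ln (81 :: real) \<le> 81 - 1" by (rule ln_le_minus_one) simp
    thus ?thesis using \<rho> by simp
  qed
  finally have "N \<le> 16 * (81 * exp (1296 * \<rho>)) * (a + b)"
    using nonneg by (simp add: mult_right_mono)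
  thus "(LINT x|lebesgue. (cmod (u\<^sub>0 x))\<^sup>2)
        \<le> 1296 * exp (1296 * r\<^sub>1 * r\<^sub>2 * (1 / (T - S))) *
          ((LINT x:- cball x' r\<^sub>1|lebesgue. (cmod (free_schrodinger u\<^sub>0 S x))\<^sup>2) +
           (LINT x:- cball x'' r\<^sub>2|lebesgue. (cmod (free_schrodinger u\<^sub>0 T x))\<^sup>2))"
    by (simp add: N_def a_def b_def \<rho>_def mult.assoc)
qed simp

end
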